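(* Let $\Delta$ be a $(d-1)$-dimensional simplicial complex, with $d\ge 1$, and let $\mathfrak m$ denote the maximal homogeneous ideal of the face ring $k[\Delta]$ over a field $k$. Then $\overline{\mathfrak m^n}=\mathfrak m^n$ for all $n$, and $$e_1(\mathfrak m)=\overline e_1(\mathfrak m)=d\,f_{d-1}-f_{d-2}.$$
   Context: $\Delta$ is a finite simplicial complex on vertices $v_1,\dots,v_s$; $f_i$ is the number of $i$-dimensional faces of $\Delta$ for $i=-1,0,\dots,d-1$, with $f_{-1}=1$. The face ring is $k[\Delta]=k[x_1,\dots,x_s]/I_\Delta$, where $I_\Delta$ is generated by the square-free monomials $x_{a_1}\cdots x_{a_m}$ with $1\le a_1<\cdots<a_m\le s$ and $\{v_{a_1},\dots,v_{a_m}\}\notin\Delta$. The maximal homogeneous ideal $\mathfrak m$ is generated by the images of $x_1,\dots,x_s$. For an ideal $K$ of a ring, $\overline K$ denotes its integral closure. $\lambda$ denotes length. The functions $n\mapsto\lambda(k[\Delta]/\mathfrak m^{n+1})$ and $n\mapsto\lambda(k[\Delta]/\overline{\mathfrak m^{n+1}})$ agree for $n\gg0$ with polynomials $P$ and $\overline P$ of degree $d=\dim k[\Delta]$. Writing a polynomial $Q$ of degree $d$ as $Q=\sum_{i=0}^d(-1)^ie_i(Q)\binom{X+d-i}{d-i}$, one sets $e_1(\mathfrak m)=e_1(P)$ and $\overline e_1(\mathfrak m)=e_1(\overline P)$. *)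

theory Defs
  imports
    "HOL-Algebra.Algebra"
    "HOL-Algebra.Algebraic_Closure_Type"
    "HOL-Algebra.Ideal_Product"
    "HOL-Library.Poly_Mapping"
    "HOL-Library.Extended_Nat"
    "HOL-Computational_Algebra.Polynomial"
begin

section \<open>Simplicial complexes\<close>

text \<open>The elements of \<open>V\<close> need not all be faces; a vertex \<open>v\<close> with \<open>{v} \<notin> \<Delta>\<close>
  contributes the generator \<open>x\<^sub>v\<close> to the Stanley--Reisner ideal.\<close>

definition simplicial_complex :: "'v set \<Rightarrow> 'v set set \<Rightarrow> bool" where
  "simplicial_complex V \<Delta> \<longleftrightarrow>
     finite V \<and> \<Delta> \<subseteq> Pow V \<and> {} \<in> \<Delta> \<and> (\<forall>\<sigma>\<in>\<Delta>. \<forall>\<tau>. \<tau> \<subseteq> \<sigma> \<longrightarrow> \<tau> \<in> \<Delta>)"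

definition face_dim :: "'v set \<Rightarrow> int" where
  "face_dim \<sigma> = int (card \<sigma>) - 1"

definition complex_dim :: "'v set set \<Rightarrow> int" where
  "complex_dim \<Delta> = Max (face_dim ` \<Delta>)"

definition face_number :: "'v set set \<Rightarrow> int \<Rightarrow> nat" where
  "face_number \<Delta> i = card {\<sigma> \<in> \<Delta>. face_dim \<sigma> = i}"


section \<open>The face ring\<close>

text \<open>A polynomial is a finitely supported map from exponent vectors to coefficients; the
  carrier consists of the polynomials in which only variables indexed by \<open>V\<close> occur.\<close>

definition polynomial_ring :: "'v set \<Rightarrow> (('v \<Rightarrow>\<^sub>0 nat) \<Rightarrow>\<^sub>0 'k::field) ring" where
  "polynomial_ring V =
     ring_of_type_algebra\<lparr>carrier := {p. \<forall>m \<in> Poly_Mapping.keys p. Poly_Mapping.keys m \<subseteq> V}\<rparr>"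

definition pvar :: "'v \<Rightarrow> (('v \<Rightarrow>\<^sub>0 nat) \<Rightarrow>\<^sub>0 'k::field)" where
  "pvar v = Poly_Mapping.single (Poly_Mapping.single v 1) 1"

definition face_ideal :: "'v set \<Rightarrow> 'v set set \<Rightarrow> (('v \<Rightarrow>\<^sub>0 nat) \<Rightarrow>\<^sub>0 'k::field) set" where
  "face_ideal V \<Delta> = Idl\<^bsub>polynomial_ring V\<^esub> {\<Prod>v\<in>A. pvar v | A. A \<subseteq> V \<and> A \<notin> \<Delta>}"

definition face_ring ::
    "'k::field itself \<Rightarrow> 'v set \<Rightarrow> 'v set set \<Rightarrow> (('v \<Rightarrow>\<^sub>0 nat) \<Rightarrow>\<^sub>0 'k) set ring" where
  "face_ring _ V \<Delta> = polynomial_ring V Quot face_ideal V \<Delta>"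

definition max_hom_ideal ::
    "'k::field itself \<Rightarrow> 'v set \<Rightarrow> 'v set set \<Rightarrow> (('v \<Rightarrow>\<^sub>0 nat) \<Rightarrow>\<^sub>0 'k) set set" where
  "max_hom_ideal K V \<Delta> =
     Idl\<^bsub>face_ring K V \<Delta>\<^esub> ((\<lambda>v. face_ideal V \<Delta> +>\<^bsub>polynomial_ring V\<^esub> pvar v) ` V)"


section \<open>Powers and integral closure of ideals\<close>

text \<open>\<^const>\<open>ideals_set\<close> has \<^const>\<open>ideal_prod\<close> as multiplication and the unit ideal as one.\<close>

definition ideal_power :: "('a, 'b) ring_scheme \<Rightarrow> 'a set \<Rightarrow> nat \<Rightarrow> 'a set" where
  "ideal_power R I n = I [^]\<^bsub>ideals_set R\<^esub> n"

definition integral_closure :: "('a, 'b) ring_scheme \<Rightarrow> 'a set \<Rightarrow> 'a set" where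
  "integral_closure R K =
     {x \<in> carrier R. \<exists>n::nat. n \<ge> 1 \<and> (\<exists>a. (\<forall>i\<in>{1..n}. a i \<in> ideal_power R K i) \<and>
        x [^]\<^bsub>R\<^esub> n \<oplus>\<^bsub>R\<^esub> (\<Oplus>\<^bsub>R\<^esub>i\<in>{1..n}. a i \<otimes>\<^bsub>R\<^esub> x [^]\<^bsub>R\<^esub> (n - i)) = \<zero>\<^bsub>R\<^esub>)}"


section \<open>Length\<close>

definition module_length :: "('a, 'c) ring_scheme \<Rightarrow> ('a, 'b, 'm) module_scheme \<Rightarrow> enat" where
  "module_length R M =
     Sup {enat n | n. \<exists>N. (\<forall>i\<le>n. submodule (N i) R M) \<and> (\<forall>i<n. N i \<subset> N (Suc i))}"

definition quotient_module :: "('a, 'b) ring_scheme \<Rightarrow> 'a set \<Rightarrow> ('a, 'a set) module" where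
  "quotient_module R J =
     \<lparr>carrier = carrier (R Quot J), monoid.mult = monoid.mult (R Quot J), monoid.one = monoid.one (R Quot J),
      ring.zero = ring.zero (R Quot J), ring.add = ring.add (R Quot J),
      module.smult = (\<lambda>r C. (J +>\<^bsub>R\<^esub> r) \<otimes>\<^bsub>R Quot J\<^esub> C)\<rparr>"


section \<open>Hilbert coefficients\<close>

definition hilbert_polynomial :: "(nat \<Rightarrow> enat) \<Rightarrow> rat poly" where
  "hilbert_polynomial h =
     (THE Q. \<forall>\<^sub>F n in sequentially. \<exists>l. h n = enat l \<and> poly Q (of_nat n) = of_nat l)"

text \<open>The coefficients \<open>e\<^sub>i\<close> of \<open>Q = (\<Sum>i\<le>d. (-1)^i * e\<^sub>i * binom (X + d - i) (d - i))\<close> with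
  \<open>d = deg Q\<close>; setting \<open>e\<^sub>i = 0\<close> for \<open>i > d\<close> makes the sequence unique.\<close>

definition binomial_coefficient :: "rat poly \<Rightarrow> nat \<Rightarrow> rat" where
  "binomial_coefficient Q =
     (THE e. (\<forall>i > Polynomial.degree Q. e i = 0) \<and>
        (\<forall>x. poly Q x = (\<Sum>i\<le>Polynomial.degree Q. (-1) ^ i * e i *
           ((x + of_nat (Polynomial.degree Q - i)) gchoose (Polynomial.degree Q - i)))))"

definition hilbert_coefficient :: "('a, 'b) ring_scheme \<Rightarrow> 'a set \<Rightarrow> nat \<Rightarrow> rat" where
  "hilbert_coefficient R I = binomial_coefficient (hilbert_polynomial
     (\<lambda>n. module_length R (quotient_module R (ideal_power R I (n + 1)))))"

definition normal_hilbert_coefficient :: "('a, 'b) ring_scheme \<Rightarrow> 'a set \<Rightarrow> nat \<Rightarrow> rat" where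
  "normal_hilbert_coefficient R I = binomial_coefficient (hilbert_polynomial
     (\<lambda>n. module_length R (quotient_module R (integral_closure R (ideal_power R I (n + 1))))))"

end

theory Submission
  imports Defs
begin

text \<open>
  The powers of \<open>\<mm>\<close> and the ideal of non-faces are spanned by monomials: \<open>\<mm>^n\<close> consists of the classes of
  polynomials all of whose monomials are supported on a non-face or have degree at least \<open>n\<close>.

  If \<open>p\<close> has a monomial of degree below \<open>n\<close> supported on a face \<open>F\<close>, then send \<open>x\<^sub>v\<close> to \<open>t^(w v)\<close> for
  \<open>v \<in> F\<close> and to \<open>0\<close> otherwise, where \<open>w v = K + w\<^sub>0 v\<close>, the weight \<open>w\<^sub>0\<close> separates the monomials of \<open>p\<close>,
  and \<open>K\<close> is large. Elements of \<open>\<mm>^i\<close> then vanish at \<open>0\<close> to order at least \<open>K i\<close>, but \<open>p\<close> to order less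
  than \<open>K n\<close>, so no equation of integral dependence of \<open>p\<close> over \<open>\<mm>^n\<close> exists.

  The length of the quotient by \<open>\<mm>^(n + 1)\<close> is the number of monomials of degree at most \<open>n\<close> supported
  on faces, which is the sum of \<open>n choose card \<sigma>\<close> over the faces \<open>\<sigma>\<close>. Vandermonde's convolution
  rewrites this polynomial in the basis \<open>(X + d - i) choose (d - i)\<close>.
\<close>

section \<open>Monomial ideals of the polynomial ring\<close>

lemma polynomial_ring_simps [simp]:
  "carrier (polynomial_ring V) = {p. \<forall>m \<in> Poly_Mapping.keys p. Poly_Mapping.keys m \<subseteq> V}"
  "monoid.mult (polynomial_ring V) = (*)"
  "monoid.one (polynomial_ring V) = 1"
  "ring.zero (polynomial_ring V) = 0"
  "ring.add (polynomial_ring V) = (+)"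
  by (simp_all add: polynomial_ring_def ring_of_type_algebra_def)

text \<open>Exponents are natural numbers, so nothing cancels: multiplying monomials can only
  enlarge the support.\<close>

lemma keys_add_nat: "Poly_Mapping.keys (m + m') = Poly_Mapping.keys m \<union> Poly_Mapping.keys m'"
  for m m' :: "'v \<Rightarrow>\<^sub>0 nat"
  by (auto simp: in_keys_iff lookup_add)

lemma keys_multE:
  assumes "m \<in> Poly_Mapping.keys (p * q)"
  obtains a b where "a \<in> Poly_Mapping.keys p" "b \<in> Poly_Mapping.keys q" "m = a + b"
  using assms keys_mult[of p q] by blast

lemma keys_uminus [simp]: "Poly_Mapping.keys (- p) = Poly_Mapping.keys p"
  for p :: "'a \<Rightarrow>\<^sub>0 'b::ab_group_add"
  by (auto simp: in_keys_iff)

lemma polynomial_ring_cring: "cring (polynomial_ring V :: (('v \<Rightarrow>\<^sub>0 nat) \<Rightarrow>\<^sub>0 'k::field) ring)"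
proof (rule cringI)
  show "abelian_group (polynomial_ring V :: (('v \<Rightarrow>\<^sub>0 nat) \<Rightarrow>\<^sub>0 'k) ring)"
  proof (rule abelian_groupI, goal_cases)
    case (1 x y)
    then show ?case using keys_add[of x y] by auto
  next
    case (6 x)
    then show ?case by (intro bexI[of _ "-x"]) auto
  qed (auto simp: algebra_simps)
  show "comm_monoid (polynomial_ring V :: (('v \<Rightarrow>\<^sub>0 nat) \<Rightarrow>\<^sub>0 'k) ring)"
    by (rule comm_monoidI) (auto simp: algebra_simps keys_add_nat elim!: keys_multE, blast+)
qed (auto simp: algebra_simps)

lemma polynomial_ring_a_inv:
  assumes "p \<in> carrier (polynomial_ring V)"
  shows "a_inv (polynomial_ring V) p = - p"
proof -
  interpret cring "polynomial_ring V :: (('a \<Rightarrow>\<^sub>0 nat) \<Rightarrow>\<^sub>0 'b) ring"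
    by (rule polynomial_ring_cring)
  show ?thesis
    using assms by (intro minus_equality) auto
qed

lemma polynomial_ring_a_minus:
  assumes "p \<in> carrier (polynomial_ring V)" "q \<in> carrier (polynomial_ring V)"
  shows "a_minus (polynomial_ring V) p q = p - q"
  using assms by (simp add: a_minus_def polynomial_ring_a_inv)

lemma poly_mapping_sum_single: "p = (\<Sum>m\<in>Poly_Mapping.keys p. Poly_Mapping.single m (Poly_Mapping.lookup p m))"
  by (rule poly_mapping_eqI)
     (auto simp: lookup_sum lookup_single when_def in_keys_iff)

text \<open>\<open>U\<close> may be any set of exponent vectors: if it is stable under
  multiplication by monomials the span is an ideal, while for the standard monomials it is just a
  vector space.\<close>

definition monomial_span :: "'v set \<Rightarrow> ('v \<Rightarrow>\<^sub>0 nat) set \<Rightarrow> (('v \<Rightarrow>\<^sub>0 nat) \<Rightarrow>\<^sub>0 'k::field) set" where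
  "monomial_span V U = {p. \<forall>m \<in> Poly_Mapping.keys p. Poly_Mapping.keys m \<subseteq> V \<and> m \<in> U}"

lemma monomial_span_carrier: "monomial_span V U \<subseteq> carrier (polynomial_ring V)"
  by (auto simp: monomial_span_def)

lemma monomial_span_zero: "0 \<in> monomial_span V U"
  by (simp add: monomial_span_def)

lemma monomial_span_add: "p \<in> monomial_span V U \<Longrightarrow> q \<in> monomial_span V U \<Longrightarrow> p + q \<in> monomial_span V U"
  using keys_add[of p q] by (auto simp: monomial_span_def)

lemma monomial_span_uminus: "p \<in> monomial_span V U \<Longrightarrow> - p \<in> monomial_span V U"
  by (auto simp: monomial_span_def)

lemma monomial_span_mult:
  assumes "p \<in> monomial_span V U" "q \<in> monomial_span V U'"
    and "\<And>m m'. m \<in> U \<Longrightarrow> m' \<in> U' \<Longrightarrow> m + m' \<in> W"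
  shows "p * q \<in> monomial_span V W"
  using assms unfolding monomial_span_def
  by (fastforce simp: keys_add_nat elim!: keys_multE)

lemma carrier_eq_monomial_span: "carrier (polynomial_ring V) = monomial_span V UNIV"
  by (auto simp: monomial_span_def)

lemma monomial_span_ideal:
  fixes V :: "'v set"
  assumes U: "\<And>m m'. m \<in> U \<Longrightarrow> m + m' \<in> U"
  shows "ideal (monomial_span V U :: (('v \<Rightarrow>\<^sub>0 nat) \<Rightarrow>\<^sub>0 'k::field) set) (polynomial_ring V)"
proof -
  interpret cring "polynomial_ring V :: (('v \<Rightarrow>\<^sub>0 nat) \<Rightarrow>\<^sub>0 'k) ring"
    by (rule polynomial_ring_cring)
  show ?thesis
  proof (rule idealI)
    show "subgroup (monomial_span V U :: (('v \<Rightarrow>\<^sub>0 nat) \<Rightarrow>\<^sub>0 'k) set) (add_monoid (polynomial_ring V))"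
    proof (rule add.subgroupI)
      show "a_inv (polynomial_ring V) p \<in> monomial_span V U"
        if "p \<in> monomial_span V U" for p :: "('v \<Rightarrow>\<^sub>0 nat) \<Rightarrow>\<^sub>0 'k"
        using that polynomial_ring_a_inv[of p V] monomial_span_carrier[of V U]
        by (auto simp: monomial_span_uminus)
    qed (use monomial_span_carrier[of V U] monomial_span_zero[of V U] in
           \<open>auto simp: monomial_span_add\<close>)
  next
    fix a x :: "('v \<Rightarrow>\<^sub>0 nat) \<Rightarrow>\<^sub>0 'k"
    assume a: "a \<in> monomial_span V U" and x: "x \<in> carrier (polynomial_ring V)"
    show *: "a \<otimes>\<^bsub>polynomial_ring V\<^esub> x \<in> monomial_span V U"
      using monomial_span_mult[OF a, of x UNIV U] x U unfolding carrier_eq_monomial_span by simp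
    then show "x \<otimes>\<^bsub>polynomial_ring V\<^esub> a \<in> monomial_span V U"
      by (simp add: mult.commute)
  qed (rule ring_axioms)
qed

text \<open>A polynomial is the sum of its terms. The scalar sits in the first premise, so the other
  premises concern addition alone.\<close>

lemma monomial_span_subset:
  assumes "\<And>m c. m \<in> U \<Longrightarrow> Poly_Mapping.keys m \<subseteq> V \<Longrightarrow> Poly_Mapping.single m c \<in> A"
    and "0 \<in> A" and "\<And>p q. p \<in> A \<Longrightarrow> q \<in> A \<Longrightarrow> p + q \<in> A"
  shows "monomial_span V U \<subseteq> A"
proof
  fix p :: "('a \<Rightarrow>\<^sub>0 nat) \<Rightarrow>\<^sub>0 'b" assume p: "p \<in> monomial_span V U"
  have "sum (\<lambda>m. Poly_Mapping.single m (Poly_Mapping.lookup p m)) M \<in> A"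
    if "finite M" "M \<subseteq> Poly_Mapping.keys p" for M
    using that
    by (induction M rule: finite_induct) (use p assms in \<open>auto simp: monomial_span_def\<close>)
  from this[OF finite_keys subset_refl] show "p \<in> A"
    by (simp flip: poly_mapping_sum_single)
qed

section \<open>The Stanley-Reisner ideal as a span of monomials\<close>

lemma prod_pvar:
  assumes "finite A"
  shows "(\<Prod>v\<in>A. pvar v) = (Poly_Mapping.single (\<Sum>v\<in>A. Poly_Mapping.single v 1) 1 :: ('v \<Rightarrow>\<^sub>0 nat) \<Rightarrow>\<^sub>0 'k::field)"
  using assms
  by (induction A rule: finite_induct) (auto simp: pvar_def mult_single)

lemma keys_sum_single:
  assumes "finite A"
  shows "Poly_Mapping.keys (\<Sum>v\<in>A. Poly_Mapping.single v (1::nat)) = A"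
  using assms by (induction A rule: finite_induct) (auto simp: keys_add_nat)

text \<open>Every exponent on the support is at least 1, so the truncated subtraction loses
  nothing.\<close>

lemma squarefree_divides:
  fixes m :: "'v \<Rightarrow>\<^sub>0 nat"
  shows "(m - (\<Sum>v\<in>Poly_Mapping.keys m. Poly_Mapping.single v 1)) + (\<Sum>v\<in>Poly_Mapping.keys m. Poly_Mapping.single v 1) = m"
  by (rule poly_mapping_eqI)
     (auto simp: lookup_add lookup_minus lookup_sum lookup_single when_def in_keys_iff)

lemma variable_divides:
  fixes m :: "'v \<Rightarrow>\<^sub>0 nat"
  assumes "v \<in> Poly_Mapping.keys m"
  shows "(m - Poly_Mapping.single v 1) + Poly_Mapping.single v 1 = m"
  using assms
  by (intro poly_mapping_eqI) (auto simp: lookup_add lookup_minus lookup_single when_def in_keys_iff)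

text \<open>A monomial whose support is not a face is a multiple of the generator on that support.
  Conversely, faces are closed under subsets, so these monomials are stable under multiplication and
  span an ideal.\<close>

lemma face_ideal_eq:
  assumes \<Delta>: "simplicial_complex V \<Delta>"
  shows "face_ideal V \<Delta> = (monomial_span V {m. Poly_Mapping.keys m \<notin> \<Delta>} :: (('v \<Rightarrow>\<^sub>0 nat) \<Rightarrow>\<^sub>0 'k::field) set)"
proof -
  let ?S = "polynomial_ring V :: (('v \<Rightarrow>\<^sub>0 nat) \<Rightarrow>\<^sub>0 'k) ring"
  let ?G = "{\<Prod>v\<in>A. pvar v | A. A \<subseteq> V \<and> A \<notin> \<Delta>} :: (('v \<Rightarrow>\<^sub>0 nat) \<Rightarrow>\<^sub>0 'k) set"
  let ?J = "monomial_span V {m. Poly_Mapping.keys m \<notin> \<Delta>} :: (('v \<Rightarrow>\<^sub>0 nat) \<Rightarrow>\<^sub>0 'k) set"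
  interpret cring ?S by (rule polynomial_ring_cring)
  have V: "finite V" and down: "\<And>\<sigma> \<tau>. \<sigma> \<in> \<Delta> \<Longrightarrow> \<tau> \<subseteq> \<sigma> \<Longrightarrow> \<tau> \<in> \<Delta>"
    using \<Delta> by (auto simp: simplicial_complex_def)
  have fin: "finite A" if "A \<subseteq> V" for A using V that finite_subset by blast
  have J: "ideal ?J ?S"
    by (rule monomial_span_ideal) (use down in \<open>auto simp: keys_add_nat\<close>)
  have GJ: "?G \<subseteq> ?J"
    using fin by (auto simp: monomial_span_def prod_pvar keys_sum_single simp del: One_nat_def)
  have GS: "?G \<subseteq> carrier ?S" using GJ monomial_span_carrier by blast
  interpret I: ideal "Idl\<^bsub>?S\<^esub> ?G" ?S by (rule genideal_ideal[OF GS])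
  have "?J \<subseteq> Idl\<^bsub>?S\<^esub> ?G"
  proof (rule monomial_span_subset)
    fix m :: "'v \<Rightarrow>\<^sub>0 nat" and c :: 'k
    assume m: "m \<in> {m. Poly_Mapping.keys m \<notin> \<Delta>}" "Poly_Mapping.keys m \<subseteq> V"
    let ?u = "\<Sum>v\<in>Poly_Mapping.keys m. Poly_Mapping.single v (1::nat)"
    have "Poly_Mapping.single ?u (1::'k) \<in> Idl\<^bsub>?S\<^esub> ?G"
      using genideal_self[OF GS] m prod_pvar[of "Poly_Mapping.keys m", where ?'k = 'k, symmetric] by auto
    moreover have "Poly_Mapping.single (m - ?u) c \<in> carrier ?S"
      using m keys_add_nat[of "m - ?u" ?u] squarefree_divides[of m] by auto
    ultimately have "Poly_Mapping.single (m - ?u) c \<otimes>\<^bsub>?S\<^esub> Poly_Mapping.single ?u (1::'k) \<in> Idl\<^bsub>?S\<^esub> ?G"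
      by (rule I.I_l_closed)
    then show "Poly_Mapping.single m c \<in> Idl\<^bsub>?S\<^esub> ?G"
      by (simp add: mult_single squarefree_divides del: One_nat_def)
  qed (use I.zero_closed I.a_closed in auto)
  moreover have "Idl\<^bsub>?S\<^esub> ?G \<subseteq> ?J"
    by (rule genideal_minimal[OF J GJ])
  ultimately show ?thesis unfolding face_ideal_def by blast
qed

section \<open>Weighted degrees and specialisations to one variable\<close>

text \<open>The exponent of \<open>t\<close> in the image of the monomial when each variable
  \<open>v\<close> is sent to \<open>t^(w v)\<close>.\<close>

definition weighted_degree :: "('v \<Rightarrow> nat) \<Rightarrow> ('v \<Rightarrow>\<^sub>0 nat) \<Rightarrow> nat" where
  "weighted_degree w m = (\<Sum>v\<in>Poly_Mapping.keys m. w v * Poly_Mapping.lookup m v)"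

abbreviation monomial_degree :: "('v \<Rightarrow>\<^sub>0 nat) \<Rightarrow> nat" where
  "monomial_degree \<equiv> weighted_degree (\<lambda>_. 1)"

lemma weighted_degree_zero [simp]: "weighted_degree w 0 = 0"
  by (simp add: weighted_degree_def)

lemma weighted_degree_add: "weighted_degree w (m + m') = weighted_degree w m + weighted_degree w m'"
  unfolding weighted_degree_def by (rule setsum_keys_plus_distrib) (simp_all add: algebra_simps)

lemma weighted_degree_single [simp]: "weighted_degree w (Poly_Mapping.single v n) = w v * n"
  by (simp add: weighted_degree_def)

lemma weighted_degree_superset:
  assumes "finite A" "Poly_Mapping.keys m \<subseteq> A"
  shows "weighted_degree w m = (\<Sum>v\<in>A. w v * Poly_Mapping.lookup m v)"
  unfolding weighted_degree_def
  by (rule sum.mono_neutral_left) (use assms in \<open>auto simp: in_keys_iff\<close>)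

lemma monomial_degree_eq_0_iff: "monomial_degree m = 0 \<longleftrightarrow> m = 0"
  by (auto simp: weighted_degree_def in_keys_iff intro!: poly_mapping_eqI)

text \<open>The exponents become the base \<open>D\<close> digits of the weighted degree.\<close>
lemma separating_weight:
  fixes V :: "'v set" and M :: "('v \<Rightarrow>\<^sub>0 nat) set"
  assumes "finite V" "finite M"
  shows "\<exists>w::'v \<Rightarrow> nat. \<forall>m\<in>M. \<forall>m'\<in>M.
    (\<Sum>v\<in>V. w v * Poly_Mapping.lookup m v) = (\<Sum>v\<in>V. w v * Poly_Mapping.lookup m' v) \<longrightarrow>
    (\<forall>v\<in>V. Poly_Mapping.lookup m v = Poly_Mapping.lookup m' v)"
  using assms(1)
proof (induction V rule: finite_induct)
  case (insert u V)
  then obtain w :: "'v \<Rightarrow> nat" where w: "\<forall>m\<in>M. \<forall>m'\<in>M.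
    (\<Sum>v\<in>V. w v * Poly_Mapping.lookup m v) = (\<Sum>v\<in>V. w v * Poly_Mapping.lookup m' v) \<longrightarrow>
    (\<forall>v\<in>V. Poly_Mapping.lookup m v = Poly_Mapping.lookup m' v)" by blast
  \<comment> \<open>Larger than every exponent of \<open>u\<close> in \<open>M\<close>: that
    exponent becomes the remainder of the new weighted degree modulo \<open>D\<close>, and the old
    weighted degree becomes the quotient.\<close>
  define D where "D = Suc (\<Sum>m\<in>M. Poly_Mapping.lookup m u)"
  have D: "Poly_Mapping.lookup m u < D" if "m \<in> M" for m
    using member_le_sum[of m M "\<lambda>m. Poly_Mapping.lookup m u"] that assms(2) by (simp add: D_def)
  define w' where "w' = (\<lambda>v. if v = u then 1 else D * w v)"
  have w': "(\<Sum>v\<in>insert u V. w' v * Poly_Mapping.lookup m v) =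
      Poly_Mapping.lookup m u + D * (\<Sum>v\<in>V. w v * Poly_Mapping.lookup m v)" for m
  proof -
    have "(\<Sum>v\<in>V. w' v * Poly_Mapping.lookup m v) = (\<Sum>v\<in>V. D * (w v * Poly_Mapping.lookup m v))"
      by (rule sum.cong) (use insert.hyps in \<open>auto simp: w'_def\<close>)
    then show ?thesis using insert.hyps by (simp add: w'_def sum_distrib_left)
  qed
  show ?case
  proof (intro exI[of _ w'] ballI impI)
    fix m m' v
    assume m: "m \<in> M" "m' \<in> M" and v: "v \<in> insert u V"
      and eq: "(\<Sum>v\<in>insert u V. w' v * Poly_Mapping.lookup m v) = (\<Sum>v\<in>insert u V. w' v * Poly_Mapping.lookup m' v)"
    have "Poly_Mapping.lookup m u = Poly_Mapping.lookup m' u"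
      using arg_cong[OF eq, of "\<lambda>x. x mod D"] D m unfolding w' by simp
    moreover have "(\<Sum>v\<in>V. w v * Poly_Mapping.lookup m v) = (\<Sum>v\<in>V. w v * Poly_Mapping.lookup m' v)"
      using eq calculation D[OF m(1)] unfolding w' by simp
    ultimately show "Poly_Mapping.lookup m v = Poly_Mapping.lookup m' v"
      using w m v by blast
  qed
qed simp

text \<open>The linear extension of \<open>h\<close>. Values on monomials are arbitrary because the
  specialisation sends some variables to 0, which no weight expresses.\<close>

definition eval_monomials :: "(('v \<Rightarrow>\<^sub>0 nat) \<Rightarrow> 'k poly) \<Rightarrow> (('v \<Rightarrow>\<^sub>0 nat) \<Rightarrow>\<^sub>0 'k::field) \<Rightarrow> 'k poly" where
  "eval_monomials h p = (\<Sum>m\<in>Poly_Mapping.keys p. Polynomial.smult (Poly_Mapping.lookup p m) (h m))"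

lemma eval_monomials_single: "eval_monomials h (Poly_Mapping.single m c) = Polynomial.smult c (h m)"
  by (simp add: eval_monomials_def)

lemma eval_monomials_add: "eval_monomials h (p + q) = eval_monomials h p + eval_monomials h q"
  unfolding eval_monomials_def by (rule setsum_keys_plus_distrib) (simp_all add: smult_add_left)

lemma eval_monomials_sum: "eval_monomials h (sum f A) = (\<Sum>a\<in>A. eval_monomials h (f a))"
  by (induction A rule: infinite_finite_induct)
     (simp_all add: eval_monomials_add eval_monomials_def[of h 0])

text \<open>By bilinearity it is enough to compare products of two terms.\<close>

lemma eval_monomials_mult:
  assumes h: "\<And>m m'. h (m + m') = h m * h m'"
  shows "eval_monomials h (p * q) = eval_monomials h p * eval_monomials h q"
proof -
  have "eval_monomials h (p * q) = (\<Sum>m\<in>Poly_Mapping.keys p. \<Sum>m'\<in>Poly_Mapping.keys q.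
      eval_monomials h (Poly_Mapping.single m (Poly_Mapping.lookup p m) * Poly_Mapping.single m' (Poly_Mapping.lookup q m')))"
    by (subst poly_mapping_sum_single[of p], subst poly_mapping_sum_single[of q])
       (simp add: sum_product eval_monomials_sum)
  also have "\<dots> = eval_monomials h p * eval_monomials h q"
    by (simp add: mult_single eval_monomials_single h)
       (simp add: eval_monomials_def sum_product mult.commute)
  finally show ?thesis .
qed

text \<open>With \<open>finsum_type_algebra\<close>, this carries an integral equation from the ring
  record to the type class, where divisibility and order of polynomials are available.\<close>

lemma nat_pow_type_algebra: "x [^]\<^bsub>ring_of_type_algebra\<^esub> (n::nat) = (x::'a::comm_ring_1) ^ n"
proof -
  interpret cring "ring_of_type_algebra :: 'a ring" by (rule cring_from_type_algebra)
  show ?thesis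
    by (induction n) (simp_all add: ring_of_type_algebra_def nat_pow_def mult.commute)
qed

lemma finsum_type_algebra:
  "finsum ring_of_type_algebra f A = (\<Sum>a\<in>A. f a :: 'a::comm_ring_1)"
proof -
  interpret cring "ring_of_type_algebra :: 'a ring" by (rule cring_from_type_algebra)
  have [simp]: "carrier (ring_of_type_algebra :: 'a ring) = UNIV" "ring.zero (ring_of_type_algebra :: 'a ring) = 0"
     "ring.add (ring_of_type_algebra :: 'a ring) = (+)"
    by (simp_all add: ring_of_type_algebra_def)
  show ?thesis
    by (induction A rule: infinite_finite_induct) (simp_all add: finsum_infinite)
qed

text \<open>Compare orders of vanishing at \<open>0\<close> on both sides of the integral equation.\<close>
lemma order_integral_equation:
  fixes z :: "'k::field poly"
  assumes N: "N \<ge> 1" and eq: "z ^ N + (\<Sum>i\<in>{1..N}. b i * z ^ (N - i)) = 0"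
    and b: "\<And>i. i \<in> {1..N} \<Longrightarrow> monom 1 (K * i) dvd b i"
  shows "monom 1 K dvd z"
proof (rule ccontr)
  assume not: "\<not> monom 1 K dvd z"
  then have z0: "z \<noteq> 0" by auto
  define r where "r = Polynomial.order 0 z"
  have X: "[:- 0, 1:] = (monom 1 1 :: 'k poly)" by (simp add: monom_altdef)
  have Xpow: "[:- 0, 1:] ^ n = (monom 1 n :: 'k poly)" for n by (simp add: monom_altdef)
  obtain u where u: "z = monom 1 r * u" "\<not> [:- 0, 1:] dvd u"
    using order_decomp[OF z0, of 0] unfolding r_def Xpow by blast
  have oK: "r < K"
  proof (rule ccontr)
    assume "\<not> r < K"
    then have "monom 1 K dvd (monom 1 r :: 'k poly)"
      unfolding Xpow[symmetric] by (intro le_imp_power_dvd) simp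
    then show False using not u(1) by (metis dvd_mult2)
  qed
  \<comment> \<open>Each summand has order at least \<open>K * i + r * (N - i)\<close>, which
    exceeds \<open>r * N\<close> because \<open>r < K\<close> and \<open>i\<close> is positive,
    while \<open>z ^ N\<close> has order exactly \<open>r * N\<close>.\<close>
  have "monom 1 (r * N + 1) dvd (\<Sum>i\<in>{1..N}. b i * z ^ (N - i))"
  proof (rule dvd_sum)
    fix i assume i: "i \<in> {1..N}"
    have "r * N + 1 \<le> K * i + r * (N - i)"
    proof -
      have "(r + 1) * i \<le> K * i" using oK by (intro mult_right_mono) auto
      moreover have "r * N = r * i + r * (N - i)" using i by (simp flip: distrib_left)
      ultimately show ?thesis using i by simp
    qed
    then have "monom 1 (r * N + 1) dvd (monom 1 (K * i + r * (N - i)) :: 'k poly)"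
      unfolding Xpow[symmetric] by (rule le_imp_power_dvd)
    also have "monom 1 (K * i + r * (N - i)) = monom 1 (K * i) * (monom 1 r :: 'k poly) ^ (N - i)"
      by (simp add: monom_power mult_monom mult.commute)
    also have "\<dots> dvd b i * z ^ (N - i)"
      using b[OF i] u(1) by (intro mult_dvd_mono dvd_power_same) auto
    finally show "monom 1 (r * N + 1) dvd b i * z ^ (N - i)" .
  qed
  then have "monom 1 (r * N + 1) dvd z ^ N"
    using eq by (metis add_eq_0_iff dvd_minus_iff)
  also have "z ^ N = monom 1 (r * N) * u ^ N"
    unfolding u(1) by (simp add: power_mult_distrib monom_power mult.commute)
  finally have "monom 1 (r * N) * monom 1 1 dvd monom 1 (r * N) * u ^ N"
    by (simp add: mult_monom)
  \<comment> \<open>With the common factor cancelled, \<open>u\<close> would vanish at 0, against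
    the choice of \<open>r\<close>.\<close>
  then have "monom 1 1 dvd u ^ N" by (simp add: monom_eq_0_iff)
  then have "poly u 0 ^ N = 0"
    unfolding X[symmetric] using dvd_iff_poly_eq_0[of 0 "u ^ N"] by (simp add: poly_eq_0_iff_dvd)
  then have "[:- 0, 1:] dvd u" by (simp add: poly_eq_0_iff_dvd)
  then show False using u(2) by blast
qed

section \<open>The face ring\<close>

lemma ideal_power_ideal:
  assumes "cring R" "ideal K R"
  shows "ideal (ideal_power R K n) R"
proof -
  interpret cring R by fact
  interpret M: comm_monoid "ideals_set R" by (rule ideals_set_is_comm_monoid)
  show ?thesis
    using M.nat_pow_closed[of K n] assms(2) by (simp add: ideal_power_def ideals_set_def)
qed

lemma ideal_power_0: "ideal_power R K 0 = carrier R"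
  by (simp add: ideal_power_def ideals_set_def nat_pow_def)

lemma ideal_power_Suc: "ideal_power R K (Suc n) = ideal_prod R (ideal_power R K n) K"
  by (simp add: ideal_power_def ideals_set_def nat_pow_def)

lemma ideal_power_1:
  assumes "cring R" "ideal K R"
  shows "ideal_power R K 1 = K"
proof -
  interpret cring R by fact
  interpret M: comm_monoid "ideals_set R" by (rule ideals_set_is_comm_monoid)
  show ?thesis
    using M.l_one[of K] assms(2) by (simp add: ideal_power_def ideals_set_def nat_pow_def)
qed

text \<open>Places the \<open>i\<close>-th coefficient of an integral equation over the
  \<open>n\<close>-th power in the power with exponent \<open>n * i\<close>.\<close>

lemma ideal_power_power:
  assumes "cring R" "ideal K R"
  shows "ideal_power R (ideal_power R K n) i = ideal_power R K (n * i)"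
proof -
  interpret cring R by fact
  interpret M: comm_monoid "ideals_set R" by (rule ideals_set_is_comm_monoid)
  show ?thesis
    using M.nat_pow_pow[of K n i] assms(2) by (simp add: ideal_power_def ideals_set_def)
qed

text \<open>An element \<open>x\<close> of \<open>K\<close> is a root of the monic linear polynomial
  \<open>X - x\<close>.\<close>

lemma subset_integral_closure:
  assumes "cring R" "ideal K R"
  shows "K \<subseteq> integral_closure R K"
proof
  interpret cring R by fact
  interpret ideal K R by fact
  fix x assume x: "x \<in> K"
  then have xc: "x \<in> carrier R" by (rule Icarr)
  have "x [^]\<^bsub>R\<^esub> (1::nat) \<oplus>\<^bsub>R\<^esub> (\<Oplus>\<^bsub>R\<^esub>i\<in>{1..1::nat}. (\<ominus>\<^bsub>R\<^esub> x) \<otimes>\<^bsub>R\<^esub> x [^]\<^bsub>R\<^esub> (1 - i)) = \<zero>\<^bsub>R\<^esub>"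
    using xc by (simp add: r_neg)
  then show "x \<in> integral_closure R K"
    unfolding integral_closure_def using xc x
    by (auto intro!: exI[of _ "1::nat"] exI[of _ "\<lambda>_. \<ominus>\<^bsub>R\<^esub> x"] simp: ideal_power_1[OF assms, simplified])
qed

text \<open>Surjectivity lifts multipliers from \<open>S\<close> to \<open>R\<close>. This serves
  both quotient maps, the one onto the face ring and the one onto its quotient by a power of the
  maximal ideal.\<close>

lemma ring_hom_image_ideal:
  assumes "ring_hom_cring R S h" and surj: "h ` carrier R = carrier S" and "ideal J R"
  shows "ideal (h ` J) S"
proof -
  interpret h: ring_hom_cring R S h by fact
  interpret J: ideal J R by fact
  show ?thesis
  proof (rule idealI)
    show "subgroup (h ` J) (add_monoid S)"
    proof (rule h.S.add.subgroupI)
      fix a assume "a \<in> h ` J"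
      then obtain p where p: "p \<in> J" "a = h p" by blast
      then have "\<ominus>\<^bsub>S\<^esub> a = h (\<ominus>\<^bsub>R\<^esub> p)" using h.hom_a_inv[OF J.Icarr[OF p(1)]] by simp
      then show "\<ominus>\<^bsub>S\<^esub> a \<in> h ` J" using p J.a_inv_closed by blast
    next
      fix a b assume "a \<in> h ` J" "b \<in> h ` J"
      then obtain p q where p: "p \<in> J" "a = h p" and q: "q \<in> J" "b = h q" by blast
      then have "a \<oplus>\<^bsub>S\<^esub> b = h (p \<oplus>\<^bsub>R\<^esub> q)" using h.hom_add[of p q] J.Icarr by metis
      then show "a \<oplus>\<^bsub>S\<^esub> b \<in> h ` J" using p q J.a_closed by blast
    qed (use J.Icarr h.hom_closed J.zero_closed in blast)+
  next
    fix a x assume "a \<in> h ` J" and x: "x \<in> carrier S"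
    then obtain p where p: "p \<in> J" "a = h p" by blast
    obtain q where q: "q \<in> carrier R" "x = h q" using x surj by blast
    have "x \<otimes>\<^bsub>S\<^esub> a = h (q \<otimes>\<^bsub>R\<^esub> p)" "a \<otimes>\<^bsub>S\<^esub> x = h (p \<otimes>\<^bsub>R\<^esub> q)"
      using p q J.Icarr h.hom_mult by metis+
    then show "x \<otimes>\<^bsub>S\<^esub> a \<in> h ` J" "a \<otimes>\<^bsub>S\<^esub> x \<in> h ` J"
      using J.I_l_closed[OF p(1) q(1)] J.I_r_closed[OF p(1) q(1)] by blast+
  qed (rule h.S.ring_axioms)
qed

text \<open>\<open>field_type\<close> fixes the coefficient field, which neither \<open>V\<close>
  nor \<open>\<Delta>\<close> determines.\<close>

locale stanley_reisner =
  fixes field_type :: "'k::field itself" and V :: "'v set" and \<Delta> :: "'v set set"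
  assumes complex: "simplicial_complex V \<Delta>"
begin

abbreviation S :: "(('v \<Rightarrow>\<^sub>0 nat) \<Rightarrow>\<^sub>0 'k) ring" where "S \<equiv> polynomial_ring V"
abbreviation I :: "(('v \<Rightarrow>\<^sub>0 nat) \<Rightarrow>\<^sub>0 'k) set" where "I \<equiv> face_ideal V \<Delta>"
abbreviation R :: "(('v \<Rightarrow>\<^sub>0 nat) \<Rightarrow>\<^sub>0 'k) set ring" where "R \<equiv> face_ring field_type V \<Delta>"
abbreviation \<mm> :: "(('v \<Rightarrow>\<^sub>0 nat) \<Rightarrow>\<^sub>0 'k) set set" where "\<mm> \<equiv> max_hom_ideal field_type V \<Delta>"
abbreviation \<pi> :: "(('v \<Rightarrow>\<^sub>0 nat) \<Rightarrow>\<^sub>0 'k) \<Rightarrow> (('v \<Rightarrow>\<^sub>0 nat) \<Rightarrow>\<^sub>0 'k) set" where "\<pi> p \<equiv> I +>\<^bsub>S\<^esub> p"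

text \<open>The classes of these monomials form a vector space basis of the quotient of the face
  ring by the \<open>n\<close>-th power of \<open>\<mm>\<close>.\<close>

definition standard_below :: "nat \<Rightarrow> ('v \<Rightarrow>\<^sub>0 nat) set" where
  "standard_below n = {m. Poly_Mapping.keys m \<in> \<Delta> \<and> monomial_degree m < n}"

section \<open>The quotient map from polynomials to the face ring\<close>

lemma finite_V: "finite V"
  and down: "\<sigma> \<in> \<Delta> \<Longrightarrow> \<tau> \<subseteq> \<sigma> \<Longrightarrow> \<tau> \<in> \<Delta>"
  and face_subset: "\<sigma> \<in> \<Delta> \<Longrightarrow> \<sigma> \<subseteq> V"
  using complex by (auto simp: simplicial_complex_def)

lemma I_eq: "I = monomial_span V {m. Poly_Mapping.keys m \<notin> \<Delta>}"
  by (rule face_ideal_eq[OF complex])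

sublocale S: cring S by (rule polynomial_ring_cring)

sublocale I: ideal I S
  unfolding I_eq by (rule monomial_span_ideal) (use down in \<open>auto simp: keys_add_nat\<close>)

sublocale R: cring R
  unfolding face_ring_def by (rule I.quotient_is_cring[OF S.is_cring])

sublocale \<pi>: ring_hom_cring S R \<pi>
  unfolding face_ring_def by (rule I.rcos_ring_hom_cring[OF S.is_cring])

lemma \<pi>_surj: "x \<in> carrier R \<Longrightarrow> \<exists>p\<in>carrier S. x = \<pi> p"
  unfolding face_ring_def by (auto simp: FactRing_def A_RCOSETS_def')

lemma \<pi>_eq_iff: "p \<in> carrier S \<Longrightarrow> q \<in> carrier S \<Longrightarrow> \<pi> p = \<pi> q \<longleftrightarrow> p - q \<in> I"
  using S.quotient_eq_iff_same_a_r_cos[OF I.ideal_axioms, of p q] polynomial_ring_a_minus[of p V q] by simp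

text \<open>Both ways of not being standard, a support outside \<open>\<Delta>\<close> and a degree
  of at least \<open>n\<close>, survive multiplication by a monomial.\<close>

lemma upclosed: "m \<in> - standard_below n \<Longrightarrow> m + m' \<in> - standard_below n"
  using down by (auto simp: standard_below_def keys_add_nat weighted_degree_add)

lemma \<pi>_add: "p \<in> carrier S \<Longrightarrow> q \<in> carrier S \<Longrightarrow> \<pi> (p + q) = \<pi> p \<oplus>\<^bsub>R\<^esub> \<pi> q"
  using \<pi>.hom_add[of p q] by simp

lemma \<pi>_mult: "p \<in> carrier S \<Longrightarrow> q \<in> carrier S \<Longrightarrow> \<pi> (p * q) = \<pi> p \<otimes>\<^bsub>R\<^esub> \<pi> q"
  using \<pi>.hom_mult[of p q] by simp

lemma \<pi>_zero: "\<pi> 0 = \<zero>\<^bsub>R\<^esub>"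
  using \<pi>.hom_zero by simp

lemma span_carrier: "p \<in> monomial_span V U \<Longrightarrow> p \<in> carrier S"
  using monomial_span_carrier[of V U] by blast

lemma vars_carrier: "(\<lambda>v. \<pi> (pvar v)) ` V \<subseteq> carrier R"
proof
  fix x assume "x \<in> (\<lambda>v. \<pi> (pvar v)) ` V"
  then obtain v where v: "v \<in> V" "x = \<pi> (pvar v)" by blast
  have "pvar v \<in> carrier S" using v by (simp add: pvar_def)
  then show "x \<in> carrier R" using \<pi>.hom_closed v by blast
qed

lemma \<mm>_ideal: "ideal \<mm> R"
  unfolding max_hom_ideal_def by (rule R.genideal_ideal[OF vars_carrier])

lemma power_ideal: "ideal (ideal_power R \<mm> n) R"
  by (rule ideal_power_ideal[OF R.is_cring \<mm>_ideal])

lemma \<pi>_image: "\<pi> ` carrier S = carrier R"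
  using \<pi>_surj \<pi>.hom_closed by blast

lemma span_image_ideal:
  assumes "\<And>m m'. m \<in> U \<Longrightarrow> m + m' \<in> U"
  shows "ideal (\<pi> ` monomial_span V U) R"
  by (rule ring_hom_image_ideal[OF \<pi>.ring_hom_cring_axioms \<pi>_image], rule monomial_span_ideal, rule assms)

lemma power_image_ideal: "ideal (\<pi> ` monomial_span V (- standard_below n)) R"
  by (rule span_image_ideal, rule upclosed)

section \<open>Powers of the maximal ideal\<close>

lemma \<mm>_subset: "\<mm> \<subseteq> \<pi> ` monomial_span V (- standard_below 1)"
  unfolding max_hom_ideal_def
proof (rule R.genideal_minimal[OF power_image_ideal])
  show "(\<lambda>v. \<pi> (pvar v)) ` V \<subseteq> \<pi> ` monomial_span V (- standard_below 1)"
    by (rule image_subsetI, rule imageI) (auto simp: monomial_span_def pvar_def standard_below_def)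
qed

lemma \<pi>_single_zero:
  assumes "Poly_Mapping.keys m \<notin> \<Delta>" "Poly_Mapping.keys m \<subseteq> V"
  shows "\<pi> (Poly_Mapping.single m c) = \<zero>\<^bsub>R\<^esub>"
proof -
  have "Poly_Mapping.single m c \<in> I" using assms by (auto simp: I_eq monomial_span_def)
  then show ?thesis
    using \<pi>_eq_iff[of "Poly_Mapping.single m c" 0] assms \<pi>_zero by auto
qed

text \<open>Induction on \<open>n\<close>: a monomial non-standard for \<open>n\<close> times one
  non-standard for 1 is non-standard for \<open>Suc n\<close>; conversely, a monomial of degree
  above \<open>n\<close> on a face splits off a variable.\<close>

lemma ideal_power_eq: "ideal_power R \<mm> n = \<pi> ` monomial_span V (- standard_below n)"
proof (induction n)
  case 0
  \<comment> \<open>No degree is below 0, in agreement with the zeroth power being the whole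
    ring.\<close>
  have "- standard_below 0 = UNIV" by (auto simp: standard_below_def)
  then show ?case
    using \<pi>_surj \<pi>.hom_closed
    by (auto simp: ideal_power_0 carrier_eq_monomial_span[symmetric] simp del: polynomial_ring_simps(1))
next
  case (Suc n)
  interpret P: ideal "ideal_power R \<mm> (Suc n)" R by (rule power_ideal)
  interpret J: ideal "\<pi> ` monomial_span V (- standard_below (Suc n))" R by (rule power_image_ideal)
  show ?case
  proof
    show "ideal_power R \<mm> (Suc n) \<subseteq> \<pi> ` monomial_span V (- standard_below (Suc n))"
    proof
      fix x assume "x \<in> ideal_power R \<mm> (Suc n)"
      then show "x \<in> \<pi> ` monomial_span V (- standard_below (Suc n))"
        unfolding ideal_power_Suc
      proof (induction rule: ideal_prod.induct)
        case (prod i j)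
        obtain p where p: "p \<in> monomial_span V (- standard_below n)" "i = \<pi> p"
          using prod Suc.IH by blast
        obtain q where q: "q \<in> monomial_span V (- standard_below 1)" "j = \<pi> q"
          using prod \<mm>_subset by blast
        have "p * q \<in> monomial_span V (- standard_below (Suc n))"
          by (rule monomial_span_mult[OF p(1) q(1)])
             (use down in \<open>auto simp: standard_below_def keys_add_nat weighted_degree_add\<close>)
        moreover have "i \<otimes>\<^bsub>R\<^esub> j = \<pi> (p * q)"
          using p q \<pi>_mult span_carrier by metis
        ultimately show ?case by blast
      next
        case (sum s1 s2)
        then show ?case using J.a_closed by blast
      qed
    qed
    \<comment> \<open>Pulling the power back to polynomials reduces the inclusion to single
      terms.\<close>
    have "monomial_span V (- standard_below (Suc n)) \<subseteq> {p \<in> carrier S. \<pi> p \<in> ideal_power R \<mm> (Suc n)}"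
    proof (rule monomial_span_subset)
      fix m :: "'v \<Rightarrow>\<^sub>0 nat" and c :: 'k
      assume m: "m \<in> - standard_below (Suc n)" and mV: "Poly_Mapping.keys m \<subseteq> V"
      have "\<pi> (Poly_Mapping.single m c) \<in> ideal_power R \<mm> (Suc n)"
      proof (cases "Poly_Mapping.keys m \<in> \<Delta>")
        case False
        then show ?thesis using \<pi>_single_zero mV P.zero_closed by metis
      next
        case True
        then have deg: "monomial_degree m \<ge> Suc n" using m by (auto simp: standard_below_def)
        then have "m \<noteq> 0" by auto
        \<comment> \<open>Any variable of \<open>m\<close> will do. The coefficient stays with the
          other factor, so that \<open>pvar v\<close> itself represents a generator of
          \<open>\<mm>\<close>.\<close>
        then obtain v where v: "v \<in> Poly_Mapping.keys m" using keys_eq_empty[of m] by blast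
        define m' where "m' = m - Poly_Mapping.single v 1"
        have m': "m' + Poly_Mapping.single v 1 = m"
          unfolding m'_def by (rule variable_divides[OF v])
        have km': "Poly_Mapping.keys m' \<subseteq> V" using mV unfolding m'[symmetric] keys_add_nat by blast
        have "monomial_degree m' \<ge> n" using deg unfolding m'[symmetric] weighted_degree_add by simp
        then have "Poly_Mapping.single m' c \<in> monomial_span V (- standard_below n)"
          using km' by (auto simp: monomial_span_def standard_below_def)
        then have 1: "\<pi> (Poly_Mapping.single m' c) \<in> ideal_power R \<mm> n" using Suc.IH by blast
        have 2: "\<pi> (pvar v) \<in> \<mm>"
          unfolding max_hom_ideal_def using R.genideal_self[OF vars_carrier] v mV by blast
        have "\<pi> (Poly_Mapping.single m c) = \<pi> (Poly_Mapping.single m' c) \<otimes>\<^bsub>R\<^esub> \<pi> (pvar v)"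
        proof -
          have "Poly_Mapping.single m c = Poly_Mapping.single m' c * pvar v"
            using m' by (simp add: pvar_def mult_single)
          moreover have "Poly_Mapping.single m' c \<in> carrier S" "pvar v \<in> carrier S"
            using km' v mV by (auto simp: pvar_def)
          ultimately show ?thesis using \<pi>_mult by metis
        qed
        then show ?thesis
          unfolding ideal_power_Suc using ideal_prod.prod[OF 1 2] by metis
      qed
      then show "Poly_Mapping.single m c \<in> {p \<in> carrier S. \<pi> p \<in> ideal_power R \<mm> (Suc n)}"
        using mV by auto
    next
      show "0 \<in> {p \<in> carrier S. \<pi> p \<in> ideal_power R \<mm> (Suc n)}"
        using \<pi>_zero P.zero_closed by simp
    next
      fix p q assume "p \<in> {p \<in> carrier S. \<pi> p \<in> ideal_power R \<mm> (Suc n)}"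
        "q \<in> {p \<in> carrier S. \<pi> p \<in> ideal_power R \<mm> (Suc n)}"
      then show "p + q \<in> {p \<in> carrier S. \<pi> p \<in> ideal_power R \<mm> (Suc n)}"
        using \<pi>_add[of p q] P.a_closed S.a_closed[of p q] by simp
    qed
    then show "\<pi> ` monomial_span V (- standard_below (Suc n)) \<subseteq> ideal_power R \<mm> (Suc n)"
      by blast
  qed
qed

text \<open>The face ideal is spanned by monomials that are non-standard for every \<open>n\<close>,
  so changing the representative does not affect the right-hand side.\<close>

lemma mem_ideal_power_iff:
  assumes "p \<in> carrier S"
  shows "\<pi> p \<in> ideal_power R \<mm> n \<longleftrightarrow> p \<in> monomial_span V (- standard_below n)"
proof
  assume "\<pi> p \<in> ideal_power R \<mm> n"
  then obtain q where q: "q \<in> monomial_span V (- standard_below n)" "\<pi> p = \<pi> q"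
    unfolding ideal_power_eq by blast
  then have "p - q \<in> I" using \<pi>_eq_iff[of p q] assms span_carrier by blast
  then have "p - q \<in> monomial_span V (- standard_below n)"
    unfolding I_eq by (auto simp: monomial_span_def standard_below_def)
  from monomial_span_add[OF this q(1)] show "p \<in> monomial_span V (- standard_below n)" by simp
qed (auto simp: ideal_power_eq)

text \<open>The specialisation \<open>x\<^sub>v \<mapsto> t^(w v)\<close> for \<open>v \<in> F\<close> and \<open>x\<^sub>v \<mapsto> 0\<close> otherwise.\<close>
lemma face_hom:
  assumes F: "F \<in> \<Delta>"
  obtains \<theta> where "ring_hom_cring R (ring_of_type_algebra :: 'k poly ring) \<theta>"
    and "\<And>q. q \<in> carrier S \<Longrightarrow>
      \<theta> (\<pi> q) = eval_monomials (\<lambda>m. if Poly_Mapping.keys m \<subseteq> F then monom 1 (weighted_degree w m) else 0) q"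
proof -
  let ?T = "ring_of_type_algebra :: 'k poly ring"
  let ?h = "\<lambda>m. if Poly_Mapping.keys m \<subseteq> F then monom (1::'k) (weighted_degree w m) else 0"
  interpret T: cring ?T by (rule cring_from_type_algebra)
  have T: "carrier ?T = UNIV" "monoid.mult ?T = (*)" "ring.add ?T = (+)" "monoid.one ?T = 1"
    by (simp_all add: ring_of_type_algebra_def)
  \<comment> \<open>A product is supported in \<open>F\<close> exactly when both factors are, so
    sending the other monomials to 0 respects products.\<close>
  have h: "?h (m + m') = ?h m * ?h m'" for m m'
    by (simp add: keys_add_nat weighted_degree_add mult_monom)
  \<comment> \<open>Evaluation kills \<open>I\<close>, hence is constant on each coset, and
    \<open>the_elem\<close> extracts the common value.\<close>
  define \<theta> where "\<theta> C = the_elem (eval_monomials ?h ` C)" for C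
  have I0: "eval_monomials ?h q = 0" if "q \<in> I" for q
    unfolding eval_monomials_def
  proof (rule sum.neutral, rule ballI)
    fix m assume "m \<in> Poly_Mapping.keys q"
    then have "Poly_Mapping.keys m \<notin> \<Delta>" using that by (auto simp: I_eq monomial_span_def)
    then have "\<not> Poly_Mapping.keys m \<subseteq> F" using down[OF F] by blast
    then show "Polynomial.smult (Poly_Mapping.lookup q m) (?h m) = 0" by simp
  qed
  have \<theta>: "\<theta> (\<pi> q) = eval_monomials ?h q" if "q \<in> carrier S" for q
  proof -
    have "eval_monomials ?h ` \<pi> q = {eval_monomials ?h q}"
      using I.zero_closed by (auto simp: a_r_coset_def' eval_monomials_add I0)
    then show ?thesis by (simp add: \<theta>_def)
  qed
  have "\<theta> \<in> ring_hom R ?T"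
  proof (rule ring_hom_memI)
    fix x y assume "x \<in> carrier R" "y \<in> carrier R"
    then obtain p q where p: "p \<in> carrier S" "x = \<pi> p" and q: "q \<in> carrier S" "y = \<pi> q"
      using \<pi>_surj by metis
    have pq: "p * q \<in> carrier S" "p + q \<in> carrier S"
      using S.m_closed[OF p(1) q(1)] S.a_closed[OF p(1) q(1)] by simp_all
    show "\<theta> (x \<otimes>\<^bsub>R\<^esub> y) = \<theta> x \<otimes>\<^bsub>?T\<^esub> \<theta> y"
      unfolding p(2) q(2) \<pi>_mult[OF p(1) q(1), symmetric] \<theta>[OF p(1)] \<theta>[OF q(1)] \<theta>[OF pq(1)] T
      by (rule eval_monomials_mult) (rule h)
    show "\<theta> (x \<oplus>\<^bsub>R\<^esub> y) = \<theta> x \<oplus>\<^bsub>?T\<^esub> \<theta> y"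
      unfolding p(2) q(2) \<pi>_add[OF p(1) q(1), symmetric] \<theta>[OF p(1)] \<theta>[OF q(1)] \<theta>[OF pq(2)] T
      by (rule eval_monomials_add)
  next
    have "\<theta> (\<pi> 1) = 1"
      using \<theta>[of 1] eval_monomials_single[of ?h 0 1] by simp
    moreover have "\<one>\<^bsub>R\<^esub> = \<pi> 1" using \<pi>.hom_one by simp
    ultimately show "\<theta> \<one>\<^bsub>R\<^esub> = \<one>\<^bsub>?T\<^esub>" by (simp add: T)
  qed (simp add: T)
  then have "ring_hom_cring R ?T \<theta>"
    by (intro ring_hom_cring.intro ring_hom_cring_axioms.intro R.is_cring T.is_cring)
  then show thesis using that \<theta> by blast
qed

section \<open>Integral closedness of the powers\<close>

lemma integral_closure_ideal_power:
  "integral_closure R (ideal_power R \<mm> n) = ideal_power R \<mm> n"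
proof
  show "ideal_power R \<mm> n \<subseteq> integral_closure R (ideal_power R \<mm> n)"
    by (rule subset_integral_closure[OF R.is_cring power_ideal])
  show "integral_closure R (ideal_power R \<mm> n) \<subseteq> ideal_power R \<mm> n"
  proof
    fix x assume "x \<in> integral_closure R (ideal_power R \<mm> n)"
    then obtain N a where x: "x \<in> carrier R" and N: "N \<ge> 1"
      and a: "\<And>i. i \<in> {1..N} \<Longrightarrow> a i \<in> ideal_power R \<mm> (n * i)"
      and eq: "x [^]\<^bsub>R\<^esub> N \<oplus>\<^bsub>R\<^esub> (\<Oplus>\<^bsub>R\<^esub>i\<in>{1..N}. a i \<otimes>\<^bsub>R\<^esub> x [^]\<^bsub>R\<^esub> (N - i)) = \<zero>\<^bsub>R\<^esub>"
      unfolding integral_closure_def ideal_power_power[OF R.is_cring \<mm>_ideal] by blast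
    obtain p where p: "p \<in> carrier S" "x = \<pi> p" using \<pi>_surj[OF x] by blast
    show "x \<in> ideal_power R \<mm> n"
    proof (rule ccontr)
      assume "x \<notin> ideal_power R \<mm> n"
      then obtain m where m: "m \<in> Poly_Mapping.keys p" "m \<in> standard_below n"
        using mem_ideal_power_iff[OF p(1)] p by (auto simp: monomial_span_def)
      define F where "F = Poly_Mapping.keys m"
      have F: "F \<in> \<Delta>" and deg: "monomial_degree m < n" using m by (auto simp: F_def standard_below_def)
      obtain w0 :: "'v \<Rightarrow> nat" where w0: "\<And>m m'. m \<in> Poly_Mapping.keys p \<Longrightarrow> m' \<in> Poly_Mapping.keys p \<Longrightarrow>
        (\<Sum>v\<in>V. w0 v * Poly_Mapping.lookup m v) = (\<Sum>v\<in>V. w0 v * Poly_Mapping.lookup m' v) \<Longrightarrow>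
        (\<forall>v\<in>V. Poly_Mapping.lookup m v = Poly_Mapping.lookup m' v)"
        using separating_weight[OF finite_V, of "Poly_Mapping.keys p"] by auto
      \<comment> \<open>\<open>K\<close> exceeds the \<open>w0\<close> degree of every monomial of
        \<open>p\<close>, so dividing the weighted degree by \<open>K\<close> gives the ordinary
        degree as quotient and the \<open>w0\<close> degree as remainder.\<close>
      define K where "K = Suc (\<Sum>m'\<in>Poly_Mapping.keys p. \<Sum>v\<in>V. w0 v * Poly_Mapping.lookup m' v)"
      have K: "(\<Sum>v\<in>V. w0 v * Poly_Mapping.lookup m' v) < K" if "m' \<in> Poly_Mapping.keys p" for m'
        using member_le_sum[of m' "Poly_Mapping.keys p" "\<lambda>m'. \<Sum>v\<in>V. w0 v * Poly_Mapping.lookup m' v"] that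
        by (simp add: K_def)
      define w where "w v = K + w0 v" for v
      have w: "weighted_degree w m' = K * monomial_degree m' + (\<Sum>v\<in>V. w0 v * Poly_Mapping.lookup m' v)"
        if "Poly_Mapping.keys m' \<subseteq> V" for m'
        unfolding weighted_degree_superset[OF finite_V that]
        by (simp add: w_def algebra_simps sum.distrib sum_distrib_left)
      let ?h = "\<lambda>m. if Poly_Mapping.keys m \<subseteq> F then monom (1::'k) (weighted_degree w m) else 0"
      obtain \<theta> where "ring_hom_cring R (ring_of_type_algebra :: 'k poly ring) \<theta>"
        and \<theta>: "\<And>q. q \<in> carrier S \<Longrightarrow> \<theta> (\<pi> q) = eval_monomials ?h q"
        using face_hom[OF F] by blast
      then interpret \<theta>: ring_hom_cring R "ring_of_type_algebra :: 'k poly ring" \<theta> by simp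
      have ac: "a i \<in> carrier R" if "i \<in> {1..N}" for i
        using a[OF that] ideal.Icarr[OF power_ideal] by blast
      have eq': "\<theta> x ^ N + (\<Sum>i\<in>{1..N}. \<theta> (a i) * \<theta> x ^ (N - i)) = 0"
      proof -
        have "\<theta> (x [^]\<^bsub>R\<^esub> N \<oplus>\<^bsub>R\<^esub> (\<Oplus>\<^bsub>R\<^esub>i\<in>{1..N}. a i \<otimes>\<^bsub>R\<^esub> x [^]\<^bsub>R\<^esub> (N - i))) = 0"
          unfolding eq using \<theta>.hom_zero by (simp add: ring_of_type_algebra_def)
        moreover have "(\<lambda>i. a i \<otimes>\<^bsub>R\<^esub> x [^]\<^bsub>R\<^esub> (N - i)) \<in> {1..N} \<rightarrow> carrier R"
          using ac x by auto
        ultimately have "\<theta> x [^]\<^bsub>ring_of_type_algebra\<^esub> N \<oplus>\<^bsub>ring_of_type_algebra\<^esub>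
            (\<Oplus>\<^bsub>ring_of_type_algebra\<^esub>i\<in>{1..N}. \<theta> (a i \<otimes>\<^bsub>R\<^esub> x [^]\<^bsub>R\<^esub> (N - i))) = 0"
          using x by (simp add: o_def R.finsum_closed)
        then have "\<theta> x ^ N + (\<Sum>i\<in>{1..N}. \<theta> (a i \<otimes>\<^bsub>R\<^esub> x [^]\<^bsub>R\<^esub> (N - i))) = 0"
          by (simp add: nat_pow_type_algebra finsum_type_algebra) (simp add: ring_of_type_algebra_def)
        moreover have "\<theta> (a i \<otimes>\<^bsub>R\<^esub> x [^]\<^bsub>R\<^esub> (N - i)) = \<theta> (a i) * \<theta> x ^ (N - i)" if "i \<in> {1..N}" for i
          using ac[OF that] x by (simp add: nat_pow_type_algebra) (simp add: ring_of_type_algebra_def)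
        ultimately show ?thesis by simp
      qed
      \<comment> \<open>Every variable has weight at least \<open>K\<close>, so ordinary degree at
        least \<open>n * i\<close> forces order at least \<open>K * n * i\<close>.\<close>
      have "monom 1 (K * n * i) dvd \<theta> (a i)" if i: "i \<in> {1..N}" for i
      proof -
        obtain q where q: "q \<in> monomial_span V (- standard_below (n * i))" "a i = \<pi> q"
          using a[OF i] unfolding ideal_power_eq by blast
        show ?thesis
          unfolding q(2) \<theta>[OF span_carrier[OF q(1)]] eval_monomials_def
        proof (rule dvd_sum)
          fix m' assume "m' \<in> Poly_Mapping.keys q"
          then have m': "Poly_Mapping.keys m' \<subseteq> V" "m' \<notin> standard_below (n * i)"
            using q(1) by (auto simp: monomial_span_def)
          show "monom 1 (K * n * i) dvd Polynomial.smult (Poly_Mapping.lookup q m') (?h m')"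
          proof (cases "Poly_Mapping.keys m' \<subseteq> F")
            case True
            \<comment> \<open>Subsets of the face \<open>F\<close> are faces, so \<open>m'\<close>
              can be non-standard only through its degree.\<close>
            then have "n * i \<le> monomial_degree m'"
              using m'(2) down[OF F] by (auto simp: standard_below_def)
            then have "K * n * i \<le> weighted_degree w m'"
              unfolding w[OF m'(1)] mult.assoc by (intro trans_le_add1 mult_le_mono2)
            then show ?thesis by (auto simp: monom_1_dvd_iff' coeff_monom)
          qed simp
        qed
      qed
      from order_integral_equation[OF N eq' this] have dvd: "monom 1 (K * n) dvd \<theta> x" .
      have mV: "Poly_Mapping.keys m' \<subseteq> V" if "m' \<in> Poly_Mapping.keys p" for m' using p(1) that by simp
      \<comment> \<open>No other monomial of \<open>p\<close> has the weighted degree of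
        \<open>m\<close>, so the term of \<open>m\<close> cannot cancel under the
        specialisation.\<close>
      have "Poly_Mapping.lookup p m' * coeff (?h m') (weighted_degree w m) = (if m' = m then Poly_Mapping.lookup p m else 0)"
        if m': "m' \<in> Poly_Mapping.keys p" for m'
      proof (cases "Poly_Mapping.keys m' \<subseteq> F \<and> weighted_degree w m' = weighted_degree w m")
        case True
        then have "K * monomial_degree m' + (\<Sum>v\<in>V. w0 v * Poly_Mapping.lookup m' v) =
            K * monomial_degree m + (\<Sum>v\<in>V. w0 v * Poly_Mapping.lookup m v)"
          using w mV m' m(1) by simp
        \<comment> \<open>Reduction modulo \<open>K\<close> leaves the \<open>w0\<close> degrees,
          which determine the monomial.\<close>
        from arg_cong[OF this, of "\<lambda>x. x mod K"]
        have "\<forall>v\<in>V. Poly_Mapping.lookup m' v = Poly_Mapping.lookup m v"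
          using w0[OF m' m(1)] K[OF m'] K[OF m(1)] by simp
        then have "m' = m"
          using mV[OF m'] mV[OF m(1)] by (intro poly_mapping_eqI) (metis in_keys_iff subsetD)
        then show ?thesis by (simp add: F_def)
      qed (auto simp: F_def)
      then have "coeff (\<theta> x) (weighted_degree w m) = (\<Sum>m'\<in>Poly_Mapping.keys p. if m' = m then Poly_Mapping.lookup p m else 0)"
        unfolding p(2) \<theta>[OF p(1)] eval_monomials_def coeff_sum coeff_smult by (intro sum.cong) auto
      also have "\<dots> \<noteq> 0" using m(1) by (simp add: in_keys_iff)
      finally have "coeff (\<theta> x) (weighted_degree w m) \<noteq> 0" .
      \<comment> \<open>The quotient by \<open>K\<close> is below \<open>n\<close> and the remainder
        below \<open>K\<close>: the order of vanishing is too small for the divisibility.\<close>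
      moreover have "weighted_degree w m < K * n"
      proof -
        have "weighted_degree w m < K * monomial_degree m + K"
          using w[OF mV[OF m(1)]] K[OF m(1)] by simp
        also have "\<dots> = K * Suc (monomial_degree m)" by simp
        also have "\<dots> \<le> K * n" using deg by (intro mult_le_mono2) simp
        finally show ?thesis .
      qed
      ultimately show False using dvd by (auto simp: monom_1_dvd_iff')
    qed
  qed
qed

end

section \<open>Counting monomials and lengths\<close>

text \<open>The support is prescribed exactly, so that over the faces these sets partition the
  standard monomials.\<close>

definition monomials_of_support :: "'v set \<Rightarrow> nat \<Rightarrow> ('v \<Rightarrow>\<^sub>0 nat) set" where
  "monomials_of_support \<sigma> n = {m. Poly_Mapping.keys m = \<sigma> \<and> monomial_degree m \<le> n}"

lemma monomials_of_support_empty: "monomials_of_support {} n = {0}"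
  by (auto simp: monomials_of_support_def weighted_degree_def)

lemma monomials_of_support_0:
  assumes "finite \<sigma>" "\<sigma> \<noteq> {}"
  shows "monomials_of_support \<sigma> 0 = {}"
  using assms by (auto simp: monomials_of_support_def weighted_degree_def in_keys_iff)

text \<open>Dividing by the variable \<open>v\<close> either keeps \<open>v\<close> in the support
  or removes it; the two cases are the two terms of Pascal's rule.\<close>

lemma monomials_of_support_Suc:
  fixes \<sigma> :: "'v set"
  assumes \<sigma>: "finite \<sigma>" "v \<notin> \<sigma>"
  shows "monomials_of_support (insert v \<sigma>) (Suc n) =
    (\<lambda>m. m + Poly_Mapping.single v 1) ` (monomials_of_support (insert v \<sigma>) n \<union> monomials_of_support \<sigma> n)"
    (is "?L = ?f ` ?R")
proof
  show "?f ` ?R \<subseteq> ?L"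
  proof
    fix m' assume "m' \<in> ?f ` ?R"
    then obtain m where m: "m \<in> ?R" and m': "m' = ?f m" by blast
    have keys: "Poly_Mapping.keys m' = insert v \<sigma>" and km: "Poly_Mapping.keys m \<subseteq> insert v \<sigma>"
      using m unfolding m' monomials_of_support_def weighted_degree_def
      by (auto simp: set_eq_iff in_keys_iff lookup_add lookup_single when_def)
    have "(\<Sum>u\<in>insert v \<sigma>. Poly_Mapping.lookup m u) = (\<Sum>u\<in>Poly_Mapping.keys m. Poly_Mapping.lookup m u)"
      by (rule sum.mono_neutral_right) (use \<sigma> km in \<open>auto simp: in_keys_iff\<close>)
    then have "(\<Sum>u\<in>insert v \<sigma>. Poly_Mapping.lookup m' u) \<le> Suc n"
      using m \<sigma> unfolding m' monomials_of_support_def weighted_degree_def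
      by (auto simp: lookup_add sum.distrib lookup_single when_def)
    then show "m' \<in> ?L" by (simp add: monomials_of_support_def weighted_degree_def keys)
  qed
  show "?L \<subseteq> ?f ` ?R"
  proof
    fix m' assume "m' \<in> ?L"
    then have keys: "Poly_Mapping.keys m' = insert v \<sigma>"
      and le: "(\<Sum>u\<in>insert v \<sigma>. Poly_Mapping.lookup m' u) \<le> Suc n"
      by (auto simp: monomials_of_support_def weighted_degree_def)
    define m where "m = m' - Poly_Mapping.single v 1"
    have pos: "Poly_Mapping.lookup m' v \<ge> 1"
      using keys by (metis in_keys_iff insertI1 less_one linorder_not_less)
    have eq: "m' = ?f m"
      unfolding m_def using pos
      by (intro poly_mapping_eqI) (auto simp: lookup_add lookup_minus lookup_single when_def)
    have iff: "u \<in> Poly_Mapping.keys m \<longleftrightarrow> u \<in> \<sigma> \<or> (u = v \<and> Poly_Mapping.lookup m v \<noteq> 0)" for u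
      using keys \<sigma>(2) unfolding eq by (auto simp: set_eq_iff in_keys_iff lookup_add lookup_single when_def split: if_splits)
    then have km: "Poly_Mapping.keys m \<subseteq> insert v \<sigma>" "Poly_Mapping.keys m = \<sigma> \<or> Poly_Mapping.keys m = insert v \<sigma>"
      by auto
    have "(\<Sum>u\<in>insert v \<sigma>. Poly_Mapping.lookup m u) = (\<Sum>u\<in>Poly_Mapping.keys m. Poly_Mapping.lookup m u)"
      by (rule sum.mono_neutral_right) (use \<sigma> km in \<open>auto simp: in_keys_iff\<close>)
    moreover have "(\<Sum>u\<in>insert v \<sigma>. Poly_Mapping.lookup m' u) = Suc (\<Sum>u\<in>insert v \<sigma>. Poly_Mapping.lookup m u)"
      using \<sigma> unfolding eq by (simp add: lookup_add sum.distrib lookup_single when_def)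
    ultimately have "m \<in> ?R" using le km(2) by (auto simp: monomials_of_support_def weighted_degree_def)
    then show "m' \<in> ?f ` ?R" using eq by blast
  qed
qed

text \<open>Induction on \<open>n\<close> by Pascal's rule. Finiteness is carried along because the
  cardinality of the disjoint union needs it.\<close>

lemma card_monomials_of_support:
  fixes \<sigma> :: "'v set"
  assumes "finite \<sigma>"
  shows "finite (monomials_of_support \<sigma> n) \<and> card (monomials_of_support \<sigma> n) = n choose card \<sigma>"
  using assms
proof (induction n arbitrary: \<sigma>)
  case 0
  then show ?case
    by (cases "\<sigma> = {}") (simp_all add: monomials_of_support_empty monomials_of_support_0 binomial_eq_0 card_gt_0_iff)
next
  case (Suc n)
  show ?case
  proof (cases "\<sigma> = {}")
    case True
    then show ?thesis by (simp add: monomials_of_support_empty)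
  next
    case False
    then obtain v \<tau> where \<sigma>: "\<sigma> = insert v \<tau>" "v \<notin> \<tau>" by (meson Set.set_insert ex_in_conv)
    with Suc.prems have \<tau>: "finite \<tau>" by simp
    have disj: "monomials_of_support (insert v \<tau>) n \<inter> monomials_of_support \<tau> n = {}"
      using \<sigma> by (auto simp: monomials_of_support_def weighted_degree_def)
    have inj: "inj_on (\<lambda>m::'v \<Rightarrow>\<^sub>0 nat. m + Poly_Mapping.single v 1) A" for A
      by (rule inj_onI) (metis add_diff_cancel_right')
    show ?thesis
      using Suc.IH[of \<tau>] Suc.IH[of "insert v \<tau>"] \<tau> \<sigma>(2) unfolding \<sigma>(1) monomials_of_support_Suc[OF \<tau> \<sigma>(2)]
      by (simp add: card_image[OF inj] card_Un_disjoint[OF _ _ disj] del: One_nat_def)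
  qed
qed

section \<open>Submodules of a quotient ring\<close>

lemma subgroup_quotient_module_iff:
  "subgroup H (add_monoid (quotient_module R J)) \<longleftrightarrow> subgroup H (add_monoid (R Quot J))"
  by (simp add: quotient_module_def subgroup_def m_inv_def)

text \<open>A scalar acts on \<open>R Quot J\<close> as multiplication by its class, which an ideal
  absorbs.\<close>

lemma ideal_imp_submodule_quotient:
  assumes "ideal J R" "ideal B (R Quot J)"
  shows "submodule B R (quotient_module R J)"
proof -
  interpret J: ideal J R by fact
  interpret B: ideal B "R Quot J" by fact
  show ?thesis
  proof (intro submodule.intro submodule_axioms.intro)
    show "subgroup B (add_monoid (quotient_module R J))"
      unfolding subgroup_quotient_module_iff by (rule B.a_subgroup)
  next
    fix a x assume "a \<in> carrier R" and x: "x \<in> B"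
    then have "J +>\<^bsub>R\<^esub> a \<in> carrier (R Quot J)"
      using ring_hom_closed[OF J.rcos_ring_hom] by blast
    then show "a \<odot>\<^bsub>quotient_module R J\<^esub> x \<in> B"
      using B.I_l_closed[OF x] by (simp add: quotient_module_def)
  qed
qed

lemma sorted_enumeration:
  fixes f :: "'a \<Rightarrow> nat"
  assumes "finite A"
  obtains xs where "set xs = A" "distinct xs" "\<And>i j. i < length xs \<Longrightarrow> j < length xs \<Longrightarrow> f (xs ! i) < f (xs ! j) \<Longrightarrow> i < j"
proof -
  obtain ys where ys: "set ys = A" "distinct ys" using finite_distinct_list[OF assms] by blast
  show thesis
  proof (rule that[of "sort_key f ys"])
    fix i j assume ij: "i < length (sort_key f ys)" "j < length (sort_key f ys)"
      and lt: "f (sort_key f ys ! i) < f (sort_key f ys ! j)"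
    show "i < j"
    proof (rule ccontr)
      assume "\<not> i < j"
      then have "map f (sort_key f ys) ! j \<le> map f (sort_key f ys) ! i"
        using ij by (intro sorted_nth_mono) auto
      then show False using lt ij by simp
    qed
  qed (use ys in auto)
qed

context stanley_reisner
begin

section \<open>The number of standard monomials\<close>

lemma finite_\<Delta>: "finite \<Delta>"
  using complex by (auto simp: simplicial_complex_def intro: finite_subset[of \<Delta> "Pow V"])

lemma finite_face: "\<sigma> \<in> \<Delta> \<Longrightarrow> finite \<sigma>"
  using face_subset finite_V finite_subset by blast

text \<open>The strict bound \<open>Suc n\<close> means degree at most \<open>n\<close>, matching
  the exponent \<open>n + 1\<close> in the Hilbert function.\<close>

lemma standard_below_Suc: "standard_below (Suc n) = (\<Union>\<sigma>\<in>\<Delta>. monomials_of_support \<sigma> n)"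
  by (auto simp: standard_below_def monomials_of_support_def)

lemma card_standard_below: "card (standard_below (Suc n)) = (\<Sum>\<sigma>\<in>\<Delta>. n choose card \<sigma>)"
proof -
  have "card (standard_below (Suc n)) = (\<Sum>\<sigma>\<in>\<Delta>. card (monomials_of_support \<sigma> n))"
    unfolding standard_below_Suc
    by (rule card_UN_disjoint) (use finite_\<Delta> finite_face card_monomials_of_support in \<open>auto simp: monomials_of_support_def\<close>)
  then show ?thesis using card_monomials_of_support[OF finite_face] by simp
qed

lemma finite_standard_below: "finite (standard_below n)"
proof -
  have "finite (standard_below (Suc n))"
    unfolding standard_below_Suc using finite_\<Delta> finite_face card_monomials_of_support by blast
  then show ?thesis by (rule rev_finite_subset) (auto simp: standard_below_def)
qed

section \<open>Length of the quotients by powers\<close>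

abbreviation \<kappa> :: "nat \<Rightarrow> (('v \<Rightarrow>\<^sub>0 nat) \<Rightarrow>\<^sub>0 'k) \<Rightarrow> (('v \<Rightarrow>\<^sub>0 nat) \<Rightarrow>\<^sub>0 'k) set set" where
  "\<kappa> n p \<equiv> ideal_power R \<mm> n +>\<^bsub>R\<^esub> \<pi> p"

lemma \<kappa>_hom: "ring_hom_cring R (R Quot ideal_power R \<mm> n) ((+>\<^bsub>R\<^esub>) (ideal_power R \<mm> n))"
  by (rule ideal.rcos_ring_hom_cring[OF power_ideal R.is_cring])

lemma \<kappa>_eq_iff:
  assumes "p \<in> carrier S" "q \<in> carrier S"
  shows "\<kappa> n p = \<kappa> n q \<longleftrightarrow> p - q \<in> monomial_span V (- standard_below n)"
proof -
  have "\<pi> p \<ominus>\<^bsub>R\<^esub> \<pi> q = \<pi> (p \<ominus>\<^bsub>S\<^esub> q)"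
    using assms by (simp add: a_minus_def \<pi>.hom_add[OF assms(1) S.a_inv_closed[OF assms(2)]] \<pi>.hom_a_inv[OF assms(2)]
      del: polynomial_ring_simps)
  also have "p \<ominus>\<^bsub>S\<^esub> q = p - q" by (rule polynomial_ring_a_minus[OF assms])
  finally have "\<pi> p \<ominus>\<^bsub>R\<^esub> \<pi> q = \<pi> (p - q)" .
  moreover have "p - q \<in> carrier S"
    using S.minus_closed[OF assms] polynomial_ring_a_minus[OF assms] by simp
  ultimately show ?thesis
    using R.quotient_eq_iff_same_a_r_cos[OF power_ideal \<pi>.hom_closed[OF assms(1)] \<pi>.hom_closed[OF assms(2)]]
      mem_ideal_power_iff by simp
qed

text \<open>Adding the standard monomials one at a time, in order of decreasing degree, keeps the span an
  ideal.\<close>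
lemma quotient_chain_exists:
  obtains N where "\<And>i. i \<le> card (standard_below n) \<Longrightarrow> submodule (N i) R (quotient_module R (ideal_power R \<mm> n))"
    and "\<And>i. i < card (standard_below n) \<Longrightarrow> N i \<subset> N (Suc i)"
proof -
  let ?J = "ideal_power R \<mm> n"
  \<comment> \<open>Increasing \<open>n - monomial_degree m\<close> is decreasing degree; the
    truncated subtraction is faithful since standard monomials have degree below
    \<open>n\<close>.\<close>
  obtain ms where ms: "set ms = standard_below n" "distinct ms"
    and sorted: "\<And>i j. i < length ms \<Longrightarrow> j < length ms \<Longrightarrow> n - monomial_degree (ms ! i) < n - monomial_degree (ms ! j) \<Longrightarrow> i < j"
    using sorted_enumeration[OF finite_standard_below[of n], of "\<lambda>m. n - monomial_degree m"] by blast
  have len: "length ms = card (standard_below n)" using ms distinct_card by fastforce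
  define U where "U i = - standard_below n \<union> set (take i ms)" for i
  have up: "m + m' \<in> U i" if m: "m \<in> U i" for m m' i
  proof (cases "m \<in> - standard_below n \<or> m' = 0 \<or> m + m' \<notin> standard_below n")
    case True
    then show ?thesis using upclosed[of m n m'] m by (auto simp: U_def)
  next
    case False
    then obtain k where k: "k < i" "k < length ms" "m = ms ! k"
      using m by (auto simp: U_def in_set_conv_nth)
    obtain l where l: "l < length ms" "m + m' = ms ! l"
      using False ms by (metis in_set_conv_nth)
    \<comment> \<open>A proper multiple has larger degree, so it is listed before
      \<open>m\<close>.\<close>
    have "monomial_degree m < monomial_degree (m + m')"
      using False monomial_degree_eq_0_iff[of m'] by (simp add: weighted_degree_add)
    moreover have "monomial_degree m < n" using False by (auto simp: standard_below_def)
    ultimately have "l < k" using sorted[of l k] k l by simp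
    then show ?thesis using l k by (auto simp: U_def in_set_conv_nth intro!: exI[of _ l])
  qed
  define N where "N i = (\<lambda>p. \<kappa> n p) ` monomial_span V (U i)" for i
  show thesis
  proof (rule that)
    fix i
    have surj: "((+>\<^bsub>R\<^esub>) ?J) ` carrier R = carrier (R Quot ?J)"
      by (auto simp: FactRing_def A_RCOSETS_def')
    have "ideal (((+>\<^bsub>R\<^esub>) ?J) ` (\<pi> ` monomial_span V (U i))) (R Quot ?J)"
      by (rule ring_hom_image_ideal[OF \<kappa>_hom surj span_image_ideal]) (rule up)
    then show "submodule (N i) R (quotient_module R ?J)"
      using ideal_imp_submodule_quotient[OF power_ideal] unfolding N_def image_image by blast
  next
    fix i assume i: "i < card (standard_below n)"
    let ?p = "Poly_Mapping.single (ms ! i) (1::'k)"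
    have mi: "ms ! i \<in> standard_below n" using ms(1) i len nth_mem by metis
    then have kV: "Poly_Mapping.keys (ms ! i) \<subseteq> V" using face_subset by (auto simp: standard_below_def)
    have "U i \<subseteq> U (Suc i)" using set_take_subset_set_take[of i "Suc i" ms] by (auto simp: U_def)
    then have "N i \<subseteq> N (Suc i)" by (auto simp: N_def monomial_span_def)
    moreover have "\<kappa> n ?p \<in> N (Suc i)"
      unfolding N_def using kV i len
      by (intro imageI) (auto simp: monomial_span_def U_def take_Suc_conv_app_nth)
    \<comment> \<open>Otherwise the new monomial would be among those already added, which
      distinctness of the list excludes.\<close>
    moreover have "\<kappa> n ?p \<notin> N i"
    proof
      assume "\<kappa> n ?p \<in> N i"
      then obtain q where q: "q \<in> monomial_span V (U i)" "\<kappa> n ?p = \<kappa> n q" by (auto simp: N_def)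
      have "?p \<in> carrier S" using kV by simp
      then have "?p - q \<in> monomial_span V (- standard_below n)"
        using \<kappa>_eq_iff q span_carrier by blast
      then have "?p - q \<in> monomial_span V (U i)" by (auto simp: monomial_span_def U_def)
      from monomial_span_add[OF this q(1)] have "ms ! i \<in> U i" by (simp add: monomial_span_def)
      then obtain k where "k < i" "ms ! i = ms ! k" using mi by (auto simp: U_def in_set_conv_nth)
      then show False using ms(2) i len by (simp add: nth_eq_iff_index_eq)
    qed
    ultimately show "N i \<subset> N (Suc i)" by blast
  qed
qed

text \<open>Pulled back to polynomials, the chain consists of subspaces. Each strict inclusion
  supplies a new vector in the span of the standard monomials, and these vectors are
  independent.\<close>

lemma quotient_chain_bound:
  assumes N: "\<And>i. i \<le> L \<Longrightarrow> submodule (N i) R (quotient_module R (ideal_power R \<mm> n))"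
    and strict: "\<And>i. i < L \<Longrightarrow> N i \<subset> N (Suc i)"
  shows "L \<le> card (standard_below n)"
proof -
  let ?J = "ideal_power R \<mm> n" let ?Q = "R Quot ideal_power R \<mm> n"
  \<comment> \<open>Multiplication by constant polynomials makes the polynomials a vector space over
    \<open>'k\<close>.\<close>
  let ?scale = "\<lambda>c p. Poly_Mapping.single 0 c * p :: ('v \<Rightarrow>\<^sub>0 nat) \<Rightarrow>\<^sub>0 'k"
  interpret q: ring_hom_cring R ?Q "(+>\<^bsub>R\<^esub>) ?J" by (rule \<kappa>_hom)
  interpret vs: vector_space ?scale
    by unfold_locales (simp_all add: distrib_left distrib_right single_add mult_single flip: mult.assoc)
  define P where "P i = {p \<in> carrier S. \<kappa> n p \<in> N i}" for i
  have sg: "subgroup (N i) (add_monoid ?Q)" if "i \<le> L" for i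
    using submodule.axioms(1)[OF N[OF that]] unfolding subgroup_quotient_module_iff .
  have P_zero: "0 \<in> P i" if "i \<le> L" for i
    using subgroup.one_closed[OF sg[OF that]] q.hom_zero by (simp add: P_def \<pi>_zero)
  have P_add: "x + y \<in> P i" if "i \<le> L" "x \<in> P i" "y \<in> P i" for i x y
  proof -
    have c: "x \<in> carrier S" "y \<in> carrier S" using that by (auto simp: P_def)
    have "\<kappa> n (x + y) = \<kappa> n x \<oplus>\<^bsub>?Q\<^esub> \<kappa> n y"
      unfolding \<pi>_add[OF c] by (rule q.hom_add[OF \<pi>.hom_closed[OF c(1)] \<pi>.hom_closed[OF c(2)]])
    then show ?thesis
      using subgroup.m_closed[OF sg[OF that(1)]] that(2,3) S.a_closed[OF c] by (simp add: P_def)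
  qed
  have P_mult: "s * x \<in> P i" if "i \<le> L" "s \<in> carrier S" "x \<in> P i" for i s x
  proof -
    have c: "x \<in> carrier S" using that by (auto simp: P_def)
    have "\<kappa> n (s * x) = \<pi> s \<odot>\<^bsub>quotient_module R ?J\<^esub> \<kappa> n x"
      unfolding \<pi>_mult[OF that(2) c] using q.hom_mult[OF \<pi>.hom_closed[OF that(2)] \<pi>.hom_closed[OF c]]
      by (simp add: quotient_module_def)
    then show ?thesis
      using submodule.smult_closed[OF N[OF that(1)] \<pi>.hom_closed[OF that(2)]] that(3) S.m_closed[OF that(2) c]
      by (simp add: P_def)
  qed
  have P_sub: "vs.subspace (P i)" if "i \<le> L" for i
    by (rule vs.subspaceI) (use P_zero P_add P_mult that in auto)
  have P_mono: "P i \<subseteq> P j" if "i \<le> j" "j \<le> L" for i j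
    using that
  proof (induction j)
    case (Suc j)
    show ?case
    proof (cases "i = Suc j")
      case False
      with Suc have "P i \<subseteq> P j" by simp
      moreover have "N j \<subseteq> N (Suc j)" using strict[of j] Suc.prems by simp
      then have "P j \<subseteq> P (Suc j)" unfolding P_def by blast
      ultimately show ?thesis by (rule subset_trans)
    qed simp
  qed simp
  have "\<exists>y. y \<in> monomial_span V (standard_below n) \<and> y \<in> P (Suc i) \<and> y \<notin> P i" if i: "i < L" for i
  proof -
    obtain c where c: "c \<in> N (Suc i)" "c \<notin> N i" using strict[OF i] by blast
    have "c \<in> carrier (add_monoid ?Q)" using subgroup.subset[OF sg[OF Suc_leI[OF i]]] c(1) by (rule subsetD)
    then obtain r where r: "r \<in> carrier R" "c = ?J +>\<^bsub>R\<^esub> r"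
      by (simp only: FactRing_def A_RCOSETS_def' monoid.simps partial_object.simps ring.simps) blast
    obtain x where x: "x \<in> carrier S" "c = \<kappa> n x"
      using \<pi>_surj[OF r(1)] r(2) by blast
    \<comment> \<open>Dropping the non-standard terms of the representative keeps its class and
      moves it into a span of finite dimension.\<close>
    define y where "y = (\<Sum>m\<in>Poly_Mapping.keys x \<inter> standard_below n. Poly_Mapping.single m (Poly_Mapping.lookup x m))"
    have lookup: "Poly_Mapping.lookup y m = (if m \<in> standard_below n then Poly_Mapping.lookup x m else 0)" for m
      by (auto simp: y_def lookup_sum lookup_single when_def in_keys_iff)
    have y: "y \<in> monomial_span V (standard_below n)"
      using x(1) by (auto simp: monomial_span_def in_keys_iff lookup split: if_splits)
    have "x - y \<in> monomial_span V (- standard_below n)"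
      using x(1) by (auto simp: monomial_span_def in_keys_iff lookup lookup_minus split: if_splits)
    then have "\<kappa> n y = c" using \<kappa>_eq_iff[OF x(1) span_carrier[OF y]] x(2) by metis
    then show ?thesis using y c span_carrier[OF y] by (auto simp: P_def)
  qed
  then obtain y where y: "\<And>i. i < L \<Longrightarrow> y i \<in> monomial_span V (standard_below n) \<and> y i \<in> P (Suc i) \<and> y i \<notin> P i"
    by metis
  let ?T = "(\<lambda>m. Poly_Mapping.single m (1::'k)) ` standard_below n"
  have span: "y ` {..<L} \<subseteq> vs.span ?T"
  proof
    fix z assume "z \<in> y ` {..<L}"
    then have z: "z \<in> monomial_span V (standard_below n)" using y by auto
    have "(\<Sum>m\<in>Poly_Mapping.keys z. ?scale (Poly_Mapping.lookup z m) (Poly_Mapping.single m 1)) \<in> vs.span ?T"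
      using z by (intro vs.span_sum vs.span_scale vs.span_base) (auto simp: monomial_span_def)
    also have "(\<Sum>m\<in>Poly_Mapping.keys z. ?scale (Poly_Mapping.lookup z m) (Poly_Mapping.single m 1)) = z"
      by (simp add: mult_single flip: poly_mapping_sum_single)
    finally show "z \<in> vs.span ?T" .
  qed
  \<comment> \<open>The earlier vectors lie in the subspace \<open>P i\<close> and
    \<open>y i\<close> does not. The cardinality records that the vectors are distinct.\<close>
  have "vs.independent (y ` {..<i}) \<and> card (y ` {..<i}) = i" if "i \<le> L" for i
    using that
  proof (induction i)
    case (Suc i)
    have iL: "i < L" using Suc.prems by simp
    have "y ` {..<i} \<subseteq> P i"
    proof (rule image_subsetI)
      fix k assume "k \<in> {..<i}"
      then have k: "Suc k \<le> i" "k < L" using iL by simp_all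
      have "P (Suc k) \<subseteq> P i" by (rule P_mono[OF k(1) less_imp_le[OF iL]])
      moreover have "y k \<in> P (Suc k)" using y[OF k(2)] by blast
      ultimately show "y k \<in> P i" by (rule subsetD)
    qed
    then have "vs.span (y ` {..<i}) \<subseteq> P i" by (rule vs.span_minimal) (rule P_sub[OF less_imp_le[OF iL]])
    then have new: "y i \<notin> vs.span (y ` {..<i})" using y[OF iL] by (meson subsetD)
    then have "y i \<notin> y ` {..<i}" by (rule contrapos_nn) (rule vs.span_base)
    moreover have "y ` {..<Suc i} = insert (y i) (y ` {..<i})" by (simp only: lessThan_Suc image_insert)
    ultimately show ?case
      using Suc.IH[OF less_imp_le[OF iL]] vs.independent_insertI[OF new]
      by (simp only: card_insert_disjoint[OF finite_imageI[OF finite_lessThan]] simp_thms)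
  qed (simp add: vs.independent_empty)
  from this[of L] have "L \<le> card ?T"
    using vs.independent_span_bound[OF finite_imageI[OF finite_standard_below] _ span] by (metis order_refl)
  also have "\<dots> \<le> card (standard_below n)" by (rule card_image_le[OF finite_standard_below])
  finally show ?thesis .
qed

lemma length_quotient_power:
  "module_length R (quotient_module R (ideal_power R \<mm> n)) = enat (card (standard_below n))"
proof -
  let ?M = "quotient_module R (ideal_power R \<mm> n)"
  let ?A = "{enat n' | n'. \<exists>N. (\<forall>i\<le>n'. submodule (N i) R ?M) \<and> (\<forall>i<n'. N i \<subset> N (Suc i))}"
  have "enat (card (standard_below n)) \<in> ?A"
    using quotient_chain_exists[of n] by (smt (verit, best) mem_Collect_eq)
  moreover have "a \<le> enat (card (standard_below n))" if "a \<in> ?A" for a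
    using that
  proof (elim CollectE exE conjE)
    fix L N
    assume "a = enat L" "\<forall>i\<le>L. submodule (N i) R ?M" "\<forall>i<L. N i \<subset> N (Suc i)"
    then show ?thesis using quotient_chain_bound[of L N n] by simp
  qed
  ultimately show ?thesis
    unfolding module_length_def by (intro antisym Sup_least Sup_upper) auto
qed

end

section \<open>Hilbert coefficients\<close>

text \<open>Negating the upper index turns this into Vandermonde's convolution.\<close>
lemma gbinomial_shift_expansion:
  fixes x :: "'a::field_char_0"
  shows "x gchoose j = (\<Sum>l\<le>j. (-1) ^ l * of_nat (j choose l) * ((x + of_nat (j - l)) gchoose (j - l)))"
proof -
  have "x gchoose j = (-1) ^ j * ((of_nat j + (- x - 1)) gchoose j)"
    by (subst gbinomial_negated_upper) (simp add: algebra_simps)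
  also have "\<dots> = (-1) ^ j * (\<Sum>l\<le>j. (of_nat j gchoose l) * ((- x - 1) gchoose (j - l)))"
    by (rule arg_cong[OF gbinomial_Vandermonde[unfolded atLeast0AtMost, symmetric]])
  also have "\<dots> = (\<Sum>l\<le>j. (-1) ^ l * of_nat (j choose l) * ((x + of_nat (j - l)) gchoose (j - l)))"
    unfolding sum_distrib_left
  proof (rule sum.cong)
    fix l assume "l \<in> {..j}"
    then have j: "(-1::'a) ^ j = (-1) ^ l * (-1) ^ (j - l)"
      by (simp flip: power_add)
    have "(- x - 1) gchoose (j - l) = (-1) ^ (j - l) * ((x + of_nat (j - l)) gchoose (j - l))"
      by (subst gbinomial_negated_upper) (simp add: algebra_simps)
    then show "(-1) ^ j * ((of_nat j gchoose l) * ((- x - 1) gchoose (j - l))) =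
        (-1) ^ l * of_nat (j choose l) * ((x + of_nat (j - l)) gchoose (j - l))"
      unfolding j by (simp add: binomial_gbinomial flip: power_mult_distrib)
  qed simp
  finally show ?thesis .
qed

text \<open>At \<open>x = - (m + 1)\<close> all terms of index above \<open>m\<close> vanish.\<close>
lemma gbinomial_shift_independent:
  fixes c :: "nat \<Rightarrow> rat"
  assumes zero: "\<And>x. (\<Sum>m\<le>d. c m * ((x + of_nat m) gchoose m)) = 0"
    and "m \<le> d"
  shows "c m = 0"
  using \<open>m \<le> d\<close>
proof (induction m rule: less_induct)
  case (less m)
  \<comment> \<open>Below \<open>m\<close> the coefficient is 0 by induction; at \<open>m\<close>
    the upper index is -1, where the binomial is a sign.\<close>
  have val: "c k * ((- of_nat (Suc m) + of_nat k) gchoose k) = (if k = m then c m * (-1) ^ m else 0)"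
    if "k \<le> d" for k
  proof -
    consider "k < m" | "k = m" | "k > m" by linarith
    then show ?thesis
    proof cases
      case 1
      then show ?thesis using less that by simp
    next
      case 2
      have "((-1::rat) gchoose m) = (-1) ^ m"
        using gbinomial_minus[of "1::rat" m] by (simp add: binomial_gbinomial[symmetric])
      then show ?thesis using 2 by simp
    next
      case 3
      then have "(- of_nat (Suc m) + of_nat k :: rat) = of_nat (k - Suc m)" by (simp add: of_nat_diff)
      then have "((- of_nat (Suc m) + of_nat k :: rat) gchoose k) = of_nat ((k - Suc m) choose k)"
        by (simp only: binomial_gbinomial)
      then show ?thesis using 3 by (simp add: binomial_eq_0)
    qed
  qed
  have "0 = (\<Sum>k\<le>d. if k = m then c m * (-1) ^ m else 0)"
    by (subst zero[of "- of_nat (Suc m)", symmetric]) (rule sum.cong; use val in simp)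
  also have "\<dots> = c m * (-1) ^ m" using less.prems by (simp add: sum.delta)
  finally show ?case by simp
qed

text \<open>Independence of the shifted binomials, applied after reversing the index, gives the
  uniqueness that \<open>THE\<close> requires.\<close>

lemma binomial_coefficient_eqI:
  assumes e0: "\<And>i. i > Polynomial.degree Q \<Longrightarrow> e i = 0"
    and eq: "\<And>x. poly Q x = (\<Sum>i\<le>Polynomial.degree Q. (-1) ^ i * e i *
           ((x + of_nat (Polynomial.degree Q - i)) gchoose (Polynomial.degree Q - i)))"
  shows "binomial_coefficient Q = e"
  unfolding binomial_coefficient_def
proof (rule the_equality)
  fix e' :: "nat \<Rightarrow> rat"
  let ?d = "Polynomial.degree Q"
  assume e': "(\<forall>i > ?d. e' i = 0) \<and> (\<forall>x. poly Q x = (\<Sum>i\<le>?d. (-1) ^ i * e' i * ((x + of_nat (?d - i)) gchoose (?d - i))))"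
  have "(\<Sum>m\<le>?d. ((-1) ^ (?d - m) * (e' (?d - m) - e (?d - m))) * ((x + of_nat m) gchoose m)) = 0" for x
  proof -
    have "(\<Sum>m\<le>?d. ((-1) ^ (?d - m) * (e' (?d - m) - e (?d - m))) * ((x + of_nat m) gchoose m))
       = (\<Sum>i\<le>?d. ((-1) ^ i * (e' i - e i)) * ((x + of_nat (?d - i)) gchoose (?d - i)))"
      by (rule sum.reindex_bij_witness[of _ "\<lambda>i. ?d - i" "\<lambda>i. ?d - i"]) auto
    also have "\<dots> = 0"
      using e' eq by (simp add: algebra_simps sum_subtractf)
    finally show ?thesis .
  qed
  from gbinomial_shift_independent[of "\<lambda>m. (-1) ^ (?d - m) * (e' (?d - m) - e (?d - m))" ?d, OF this]
  have "e' (?d - m) = e (?d - m)" if "m \<le> ?d" for m using that by simp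
  then have "e' i = e i" if "i \<le> ?d" for i using that by (metis diff_diff_cancel diff_le_self)
  then show "e' = e" using e' e0 by (metis linorder_not_less ext)
qed (use assms in auto)

text \<open>Any two candidates agree at all large naturals, hence at infinitely many points.\<close>

lemma hilbert_polynomial_eqI:
  assumes "\<And>n. h n = enat (l n)" "\<And>n. poly Q (of_nat n) = of_nat (l n)"
  shows "hilbert_polynomial h = Q"
  unfolding hilbert_polynomial_def
proof (rule the_equality)
  fix P :: "rat poly" assume "\<forall>\<^sub>F n in sequentially. \<exists>l. h n = enat l \<and> poly P (of_nat n) = of_nat l"
  then obtain N where "\<And>n::nat. n \<ge> N \<Longrightarrow> poly P (of_nat n) = poly Q (of_nat n)"
    using assms by (auto simp: eventually_sequentially)
  then have "of_nat ` {N..} \<subseteq> {x. poly (P - Q) x = 0}" by auto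
  moreover have "infinite (of_nat ` {N..} :: rat set)"
    by (simp add: finite_image_iff inj_on_def infinite_Ici)
  ultimately have "infinite {x. poly (P - Q) x = 0}" using finite_subset by blast
  then show "P = Q" using poly_roots_finite[of "P - Q"] by auto
qed (use assms in auto)

text \<open>The binomial \<open>X choose j\<close> as a polynomial: a falling factorial divided by
  \<open>fact j\<close>.\<close>

definition gbinomial_poly :: "nat \<Rightarrow> rat poly" where
  "gbinomial_poly j = Polynomial.smult (1 / fact j) (\<Prod>i<j. [:- of_nat i, 1:])"

lemma poly_gbinomial_poly: "poly (gbinomial_poly j) x = x gchoose j"
  by (simp add: gbinomial_poly_def gbinomial_prod_rev poly_prod lessThan_atLeast0)

lemma degree_gbinomial_poly: "Polynomial.degree (gbinomial_poly j) = j"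
  by (simp add: gbinomial_poly_def degree_prod_eq_sum_degree)

lemma lead_coeff_gbinomial_poly: "coeff (gbinomial_poly j) j \<noteq> 0"
proof -
  have "gbinomial_poly j \<noteq> 0" by (simp add: gbinomial_poly_def)
  then show ?thesis using leading_coeff_0_iff[of "gbinomial_poly j"] degree_gbinomial_poly[of j] by simp
qed

text \<open>Expanding each binomial in the shifted basis gives all coefficients; at index 1 only
  \<open>j = d\<close> and \<open>j = d - 1\<close> contribute.\<close>

lemma binomial_coefficient_1:
  fixes c :: "nat \<Rightarrow> rat"
  assumes d: "d \<ge> 1" and c: "c d \<noteq> 0"
  defines "Q \<equiv> \<Sum>j\<le>d. Polynomial.smult (c j) (gbinomial_poly j)"
  shows "binomial_coefficient Q 1 = of_nat d * c d - c (d - 1)"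
proof -
  \<comment> \<open>The contribution of \<open>c j\<close> to \<open>(-1) ^ i * e i\<close>: the
    summand of the expansion with \<open>j - l = d - i\<close>, that is
    \<open>l = i + j - d\<close>. The test excludes negative \<open>l\<close>, which truncated
    subtraction would turn into 0.\<close>
  define s where "s i j = (if d \<le> i + j then c j * (-1) ^ (i + j - d) * of_nat (j choose (i + j - d)) else 0)" for i j
  define e where "e i = (if i \<le> d then (-1) ^ i * (\<Sum>j\<le>d. s i j) else 0)" for i
  \<comment> \<open>The basis in \<open>binomial_coefficient\<close> depends on the degree, so it
    matters that the top coefficient does not vanish.\<close>
  have deg: "Polynomial.degree Q = d"
  proof (rule antisym)
    show "Polynomial.degree Q \<le> d"
      unfolding Q_def
      by (rule degree_sum_le) (auto intro!: order_trans[OF degree_smult_le] simp: degree_gbinomial_poly)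
    have "coeff Q d = (\<Sum>j\<le>d. if j = d then c d * coeff (gbinomial_poly d) d else 0)"
      unfolding Q_def coeff_sum coeff_smult
      by (rule sum.cong) (auto simp: coeff_eq_0 degree_gbinomial_poly)
    then have "coeff Q d \<noteq> 0" using c lead_coeff_gbinomial_poly by simp
    then show "d \<le> Polynomial.degree Q" by (rule le_degree)
  qed
  have "binomial_coefficient Q = e"
  proof (rule binomial_coefficient_eqI; unfold deg)
    fix x :: rat
    have inner: "(\<Sum>i\<le>d. s i j * ((x + of_nat (d - i)) gchoose (d - i))) = c j * (x gchoose j)" if j: "j \<le> d" for j
    proof -
      have "(\<Sum>i\<le>d. s i j * ((x + of_nat (d - i)) gchoose (d - i)))
          = (\<Sum>i\<in>{d - j..d}. s i j * ((x + of_nat (d - i)) gchoose (d - i)))"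
        by (rule sum.mono_neutral_right) (auto simp: s_def)
      also have "\<dots> = (\<Sum>l\<le>j. c j * ((-1) ^ l * of_nat (j choose l) * ((x + of_nat (j - l)) gchoose (j - l))))"
      proof (rule sum.reindex_bij_witness[of _ "\<lambda>l. l + (d - j)" "\<lambda>i. i + j - d"])
        fix i assume "i \<in> {d - j..d}"
        then have "d - i = j - (i + j - d)" "d \<le> i + j" using j by auto
        then show "c j * ((-1) ^ (i + j - d) * of_nat (j choose (i + j - d)) *
            ((x + of_nat (j - (i + j - d))) gchoose (j - (i + j - d)))) = s i j * ((x + of_nat (d - i)) gchoose (d - i))"
          by (simp add: s_def)
      qed (use j in auto)
      also have "\<dots> = c j * (x gchoose j)"
        by (simp only: gbinomial_shift_expansion[of x j] sum_distrib_left)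
      finally show ?thesis .
    qed
    have "(\<Sum>i\<le>d. (-1) ^ i * e i * ((x + of_nat (d - i)) gchoose (d - i)))
        = (\<Sum>i\<le>d. \<Sum>j\<le>d. s i j * ((x + of_nat (d - i)) gchoose (d - i)))"
      by (rule sum.cong) (auto simp: e_def sum_distrib_right mult.assoc[symmetric] power_mult_distrib[symmetric])
    also have "\<dots> = (\<Sum>j\<le>d. c j * (x gchoose j))"
      by (subst sum.swap) (rule sum.cong[OF refl], rule inner, simp)
    also have "\<dots> = poly Q x"
      by (simp add: Q_def poly_sum poly_gbinomial_poly)
    finally show "poly Q x = (\<Sum>i\<le>d. (-1) ^ i * e i * ((x + of_nat (d - i)) gchoose (d - i)))" by simp
  qed (simp add: e_def)
  moreover have "(\<Sum>j\<le>d. s 1 j) = (\<Sum>j\<in>{d - 1, d}. s 1 j)"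
    by (rule sum.mono_neutral_right) (auto simp: s_def)
  \<comment> \<open>Here \<open>l\<close> is 1 and 0 respectively; the sign in \<open>e\<close> then
    yields the difference.\<close>
  moreover have "s 1 d = - of_nat d * c d" "s 1 (d - 1) = c (d - 1)"
    using d by (auto simp: s_def)
  ultimately show ?thesis using d by (simp add: e_def)
qed

section \<open>The first Hilbert coefficient in terms of face numbers\<close>

theorem lemma2p2:
  fixes V :: "'v set" and \<Delta> :: "'v set set" and d :: nat
  defines "R \<equiv> face_ring TYPE('k::field) V \<Delta>"
    and "\<mm> \<equiv> max_hom_ideal TYPE('k) V \<Delta>"
  assumes "simplicial_complex V \<Delta>"
    and "d \<ge> 1"
    and "complex_dim \<Delta> = int d - 1"
  shows "(\<forall>n. integral_closure R (ideal_power R \<mm> n) = ideal_power R \<mm> n) \<and>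
         hilbert_coefficient R \<mm> 1 = normal_hilbert_coefficient R \<mm> 1 \<and>
         normal_hilbert_coefficient R \<mm> 1 =
           of_nat d * of_nat (face_number \<Delta> (int d - 1)) - of_nat (face_number \<Delta> (int d - 2))"
proof -
  interpret stanley_reisner "TYPE('k)" V \<Delta> by unfold_locales fact
  have closed: "integral_closure R (ideal_power R \<mm> n) = ideal_power R \<mm> n" for n
    unfolding R_def \<mm>_def by (rule integral_closure_ideal_power)
  have normal: "normal_hilbert_coefficient R \<mm> = hilbert_coefficient R \<mm>"
    by (simp add: normal_hilbert_coefficient_def hilbert_coefficient_def closed)
  \<comment> \<open>Faces are counted by their number of vertices, which is the dimension plus
    one.\<close>
  define c :: "nat \<Rightarrow> nat" where "c j = card {\<sigma> \<in> \<Delta>. card \<sigma> = j}" for j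
  have "\<Delta> \<noteq> {}" using complex by (auto simp: simplicial_complex_def)
  then have "int d - 1 \<in> face_dim ` \<Delta>" and le: "\<And>\<sigma>. \<sigma> \<in> \<Delta> \<Longrightarrow> face_dim \<sigma> \<le> int d - 1"
    using assms(5) finite_\<Delta> Max_in[of "face_dim ` \<Delta>"] Max_ge[of "face_dim ` \<Delta>"]
    by (auto simp: complex_dim_def)
  \<comment> \<open>The maximum defining the dimension is attained, which makes the leading
    coefficient nonzero.\<close>
  then have "{\<sigma> \<in> \<Delta>. card \<sigma> = d} \<noteq> {}" by (auto simp: face_dim_def)
  then have cd: "c d \<noteq> 0" using finite_\<Delta> by (auto simp: c_def)
  have card_le: "card \<sigma> \<le> d" if "\<sigma> \<in> \<Delta>" for \<sigma> using le[OF that] by (simp add: face_dim_def)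
  let ?Q = "\<Sum>j\<le>d. Polynomial.smult (of_nat (c j)) (gbinomial_poly j)"
  have "hilbert_polynomial (\<lambda>n. module_length R (quotient_module R (ideal_power R \<mm> (n + 1)))) = ?Q"
  proof (rule hilbert_polynomial_eqI)
    fix n
    show "module_length R (quotient_module R (ideal_power R \<mm> (n + 1))) = enat (\<Sum>\<sigma>\<in>\<Delta>. n choose card \<sigma>)"
      unfolding R_def \<mm>_def length_quotient_power by (simp add: card_standard_below)
    have "(\<Sum>\<sigma>\<in>\<Delta>. n choose card \<sigma>) = (\<Sum>j\<le>d. \<Sum>\<sigma>\<in>{\<sigma> \<in> \<Delta>. card \<sigma> = j}. n choose card \<sigma>)"
      by (rule sum.group[symmetric]) (use finite_\<Delta> card_le in auto)
    also have "\<dots> = (\<Sum>j\<le>d. c j * (n choose j))"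
      by (simp add: c_def)
    finally show "poly ?Q (of_nat n) = of_nat (\<Sum>\<sigma>\<in>\<Delta>. n choose card \<sigma>)"
      by (simp add: poly_sum poly_gbinomial_poly binomial_gbinomial)
  qed
  then have "hilbert_coefficient R \<mm> 1 = of_nat d * of_nat (c d) - of_nat (c (d - 1))"
    using binomial_coefficient_1[OF assms(4), of "\<lambda>j. of_nat (c j)"] cd
    by (simp add: hilbert_coefficient_def)
  moreover have "face_number \<Delta> (int d - 1) = c d"
    by (simp add: face_number_def face_dim_def c_def)
  \<comment> \<open>\<open>d \<ge> 1\<close> keeps the subtraction \<open>d - 1\<close> exact; for
    \<open>d = 1\<close> the empty face, of dimension -1, is counted.\<close>
  moreover have "face_number \<Delta> (int d - 2) = c (d - 1)"
    using assms(4) unfolding face_number_def face_dim_def c_def by (intro arg_cong[where f = card]) auto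
  ultimately show ?thesis using closed normal by simp
qed

end
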